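(* Let $\mathcal{A}$ be a C*-algebra and $a\in\mathcal{A}^+$. For every continuous hermitian linear functional $f$ on $\mathcal{A}$, $$\|a^{1/2}fa^{1/2}\|=\inf\{f_1(a)+f_2(a):f=f_1-f_2,\ f_1,f_2\in\mathcal{A}^{*+}\}.$$
   Context: $\mathcal{A}^{*+}$ is the set of positive continuous linear functionals on $\mathcal{A}$. For $f\in\mathcal{A}^*$, $a^{1/2}fa^{1/2}$ is the functional $x\mapsto f(a^{1/2}xa^{1/2})$, and $\|\cdot\|$ is the norm of $\mathcal{A}^*$. *)

theory Defs
  imports "HOL-Analysis.Analysis"
begin

text \<open>C*-algebras (not necessarily unital): a real Banach algebra with a compatible
  complex scalar multiplication and an involution satisfying the C*-identity.\<close>

class cstar_algebra = real_normed_algebra + banach +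
  fixes scaleC :: "complex \<Rightarrow> 'a \<Rightarrow> 'a"
    and cstar :: "'a \<Rightarrow> 'a"
  assumes scaleR_scaleC: "scaleR r x = scaleC (complex_of_real r) x"
    and scaleC_add_right: "scaleC c (x + y) = scaleC c x + scaleC c y"
    and scaleC_add_left: "scaleC (c + d) x = scaleC c x + scaleC d x"
    and scaleC_scaleC: "scaleC c (scaleC d x) = scaleC (c * d) x"
    and scaleC_one: "scaleC 1 x = x"
    and norm_scaleC: "norm (scaleC c x) = cmod c * norm x"
    and mult_scaleC_left: "scaleC c x * y = scaleC c (x * y)"
    and mult_scaleC_right: "x * scaleC c y = scaleC c (x * y)"
    and cstar_cstar: "cstar (cstar x) = x"
    and cstar_add: "cstar (x + y) = cstar x + cstar y"
    and cstar_scaleC: "cstar (scaleC c x) = scaleC (cnj c) (cstar x)"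
    and cstar_mult: "cstar (x * y) = cstar y * cstar x"
    and cstar_identity: "norm (cstar x * x) = norm x * norm x"

text \<open>Quasi-invertibility: x is quasi-invertible iff 1 - x is invertible in the unitization.\<close>
definition quasi_invertible :: "'a::cstar_algebra \<Rightarrow> bool" where
  "quasi_invertible x \<longleftrightarrow> (\<exists>y. x + y - x * y = 0 \<and> x + y - y * x = 0)"

text \<open>Spectrum (computed in the unitization, so it always contains 0):
  for \<lambda> \<noteq> 0, \<lambda>1 - a is invertible iff a/\<lambda> is quasi-invertible.\<close>
definition cstar_spectrum :: "'a::cstar_algebra \<Rightarrow> complex set" where
  "cstar_spectrum a = {z. z = 0 \<or> \<not> quasi_invertible (scaleC (inverse z) a)}"

text \<open>The positive cone A^+: self-adjoint elements with non-negative spectrum.\<close>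
definition cstar_positive :: "'a::cstar_algebra \<Rightarrow> bool" where
  "cstar_positive a \<longleftrightarrow> cstar a = a \<and> cstar_spectrum a \<subseteq> complex_of_real ` {0..}"

text \<open>The positive square root a^{1/2} of a positive element.\<close>
definition cstar_sqrt :: "'a::cstar_algebra \<Rightarrow> 'a" where
  "cstar_sqrt a = (THE b. cstar_positive b \<and> b * b = a)"

text \<open>Continuous (complex-)linear functionals on A, i.e. elements of A^*.\<close>
definition cbounded_functional :: "('a::cstar_algebra \<Rightarrow> complex) \<Rightarrow> bool" where
  "cbounded_functional f \<longleftrightarrow>
     (\<forall>x y. f (x + y) = f x + f y) \<and> (\<forall>c x. f (scaleC c x) = c * f x) \<and>
     (\<exists>K. \<forall>x. cmod (f x) \<le> norm x * K)"

definition hermitian_functional :: "('a::cstar_algebra \<Rightarrow> complex) \<Rightarrow> bool" where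
  "hermitian_functional f \<longleftrightarrow> (\<forall>x. f (cstar x) = cnj (f x))"

text \<open>A^{*+}: positive continuous linear functionals.\<close>
definition positive_functional :: "('a::cstar_algebra \<Rightarrow> complex) \<Rightarrow> bool" where
  "positive_functional f \<longleftrightarrow> cbounded_functional f \<and>
     (\<forall>x. cstar_positive x \<longrightarrow> Im (f x) = 0 \<and> Re (f x) \<ge> 0)"

end

theory Submission
  imports Defs
begin

text \<open>
  Write \<open>s = a\<^sup>1\<^sup>/\<^sup>2\<close>. If \<open>f = f\<^sub>1 - f\<^sub>2\<close> with positive parts, then for self-adjoint \<open>x\<close> one has
  \<open>-\<parallel>x\<parallel> s\<^sup>2 \<le> s x s \<le> \<parallel>x\<parallel> s\<^sup>2\<close>, which bounds \<open>f (s x s)\<close> by \<open>\<parallel>x\<parallel> (f\<^sub>1 a + f\<^sub>2 a)\<close>; a phase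
  rotation reduces general \<open>x\<close> to this case.

  Conversely, a decomposition with \<open>f\<^sub>1 a + f\<^sub>2 a \<le> \<parallel>s f s\<parallel> + \<epsilon>\<close> is the same as a bounded functional
  \<open>h = f\<^sub>1\<close> on the self-adjoint part with \<open>h \<ge> 0\<close> and \<open>h \<ge> f\<close> on positive elements and
  \<open>2 h a \<le> f a + \<parallel>s f s\<parallel> + \<epsilon>\<close>. By Hahn--Banach it exists once \<open>f (y - x) \<le> t (\<parallel>s f s\<parallel> + \<epsilon>) + K \<parallel>v\<parallel>\<close>
  whenever \<open>x, y \<ge> 0\<close> and \<open>t a = x + y + v\<close>. This holds because \<open>y - x\<close> lies between
  \<open>\<plusminus> (t a + \<kappa>\<^sup>2)\<close> for \<open>\<kappa>\<^sup>2 \<ge> \<parallel>v\<parallel>\<close>, hence equals \<open>c u c\<close> with \<open>c = \<surd>t s + \<kappa>\<close> and \<open>\<parallel>u\<parallel> \<le> 1\<close>.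

  Inequalities involving scalars are read in the unitization. The only analytic input is that a
  self-adjoint element with spectrum in \<open>[-r, r]\<close> has norm at most \<open>r\<close>; it is obtained by averaging
  resolvents over roots of unity, without holomorphic functions.
\<close>

section \<open>Elementary rules for complex scalars and the involution\<close>

lemma scaleC_zero_right [simp]: "scaleC c (0::'a::cstar_algebra) = 0"
  using scaleC_add_right[of c "0::'a" 0] by simp

lemma scaleC_zero_left [simp]: "scaleC 0 (x::'a::cstar_algebra) = 0"
  using scaleC_add_left[of 0 0 x] by simp

lemma scaleC_minus_right: "scaleC c (- x) = - scaleC c (x::'a::cstar_algebra)"
  using scaleC_add_right[of c x "- x"] by (simp add: eq_neg_iff_add_eq_0 add.commute)

lemma scaleC_minus_left: "scaleC (- c) x = - scaleC c (x::'a::cstar_algebra)"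
  using scaleC_add_left[of c "- c" x] by (simp add: eq_neg_iff_add_eq_0 add.commute)

lemma scaleC_diff_right: "scaleC c (x - y) = scaleC c x - scaleC c (y::'a::cstar_algebra)"
  using scaleC_add_right[of c x "- y"] by (simp add: scaleC_minus_right)

lemma scaleC_diff_left: "scaleC (c - d) x = scaleC c x - scaleC d (x::'a::cstar_algebra)"
  using scaleC_add_left[of c "- d" x] by (simp add: scaleC_minus_left)

lemma cstar_zero [simp]: "cstar (0::'a::cstar_algebra) = 0"
  using cstar_add[of "0::'a" 0] by simp

lemma cstar_minus: "cstar (- x) = - cstar (x::'a::cstar_algebra)"
  using cstar_add[of x "- x"] by (simp add: eq_neg_iff_add_eq_0 add.commute)

lemma cstar_diff: "cstar (x - y) = cstar x - cstar (y::'a::cstar_algebra)"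
  using cstar_add[of x "- y"] by (simp add: cstar_minus)

lemma cstar_scaleR: "cstar (r *\<^sub>R x) = r *\<^sub>R cstar (x::'a::cstar_algebra)"
  by (simp add: scaleR_scaleC cstar_scaleC)

text \<open>The C*-identity and submultiplicativity give
  \<open>norm z * norm z \<le> norm (cstar z) * norm z\<close>. Cancelling one factor and applying
  the result to \<open>cstar x\<close> too yields equality.\<close>

lemma norm_cstar [simp]: "norm (cstar x) = norm (x::'a::cstar_algebra)"
proof -
  have le: "norm z \<le> norm (cstar z)" for z :: 'a
  proof (cases "z = 0")
    case False
    have "norm z * norm z \<le> norm (cstar z) * norm z"
      by (metis cstar_identity norm_mult_ineq)
    then show ?thesis using False by simp
  qed simp
  show ?thesis using le[of x] le[of "cstar x"] by (simp add: cstar_cstar)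
qed

lemma norm_mult_cstar: "norm (x * cstar x) = norm x * norm (x::'a::cstar_algebra)"
  using cstar_identity[of "cstar x"] by (simp add: cstar_cstar)

section \<open>The unitization\<close>

text \<open>A fresh type, because the product with \<open>complex\<close> already carries a norm,
  and that one is not a C*-norm.\<close>

datatype 'a unitization = Unitization (alg: 'a) (scal: complex)

text \<open>The algebra is an ideal of its unitization; this is the action of the unitization on
  that ideal, whose operator norm enters the norm below.\<close>

definition left_mult :: "'a::cstar_algebra unitization \<Rightarrow> 'a \<Rightarrow> 'a" where
  "left_mult X y = alg X * y + scaleC (scal X) y"

lemma bounded_linear_left_mult: "bounded_linear (left_mult X)"
proof (rule bounded_linear_intro)
  show "norm (left_mult X y) \<le> norm y * (norm (alg X) + cmod (scal X))" for y
  proof -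
    have "norm (left_mult X y) \<le> norm (alg X * y) + norm (scaleC (scal X) y)"
      unfolding left_mult_def by (rule norm_triangle_ineq)
    also have "\<dots> \<le> norm (alg X) * norm y + cmod (scal X) * norm y"
      by (simp add: norm_mult_ineq norm_scaleC)
    finally show ?thesis by (simp add: algebra_simps)
  qed
qed (simp_all add: left_mult_def algebra_simps scaleC_add_right scaleR_scaleC mult_scaleC_right
       scaleC_scaleC)

lemma norm_left_mult_le: "norm (left_mult X y) \<le> onorm (left_mult X) * norm y"
  by (rule onorm[OF bounded_linear_left_mult])

text \<open>The operator norm alone is degenerate when the algebra already has a unit; the maximum with
  the modulus of the scalar part is a C*-norm in every case.\<close>

instantiation unitization :: (cstar_algebra) real_normed_algebra_1
begin

definition "0 = Unitization 0 0"
definition "1 = Unitization 0 1"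
definition "X + Y = Unitization (alg X + alg Y) (scal X + scal Y)"
definition "X - Y = Unitization (alg X - alg Y) (scal X - scal Y)"
definition "- X = Unitization (- alg X) (- scal X)"
definition "X * Y = Unitization
  (alg X * alg Y + scaleC (scal X) (alg Y) + scaleC (scal Y) (alg X)) (scal X * scal Y)"
definition "scaleR r X = Unitization (r *\<^sub>R alg X) (complex_of_real r * scal X)"
definition "norm X = max (cmod (scal X)) (onorm (left_mult X))"
definition "dist X Y = norm (X - Y :: 'a unitization)"
definition "sgn X = inverse (norm X) *\<^sub>R (X :: 'a unitization)"
definition "(uniformity :: ('a unitization \<times> 'a unitization) filter) = (INF e\<in>{0<..}. principal {(x, y). dist x y < e})"
definition "open (U :: 'a unitization set) = (\<forall>x\<in>U. eventually (\<lambda>(x', y). x' = x \<longrightarrow> y \<in> U) uniformity)"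

lemmas unitization_ops = zero_unitization_def one_unitization_def plus_unitization_def
  minus_unitization_def uminus_unitization_def times_unitization_def
  scaleR_unitization_def

lemma left_mult_add: "left_mult (X + Y) y = left_mult X y + left_mult Y y"
  by (simp add: left_mult_def unitization_ops algebra_simps scaleC_add_left)

lemma left_mult_mult: "left_mult (X * Y) y = left_mult X (left_mult Y y)"
  by (simp add: left_mult_def unitization_ops scaleC_scaleC scaleC_add_right
        mult_scaleC_left mult_scaleC_right algebra_simps)

lemma norm_unitization_ge0: "0 \<le> norm (X::'a unitization)"
  by (simp add: norm_unitization_def le_max_iff_disj)

lemma norm_unitization_mult_le: "norm (X * Y) \<le> norm X * norm (Y::'a unitization)"
proof -
  have "norm (left_mult (X * Y) y) \<le> norm X * norm Y * norm y" for y
  proof -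
    have "norm (left_mult (X * Y) y) \<le> onorm (left_mult X) * norm (left_mult Y y)"
      by (simp add: left_mult_mult norm_left_mult_le)
    also have "\<dots> \<le> norm X * (norm Y * norm y)"
    proof (rule mult_mono)
      show "norm (left_mult Y y) \<le> norm Y * norm y"
        by (rule order_trans[OF norm_left_mult_le])
          (simp add: norm_unitization_def mult_right_mono)
    qed (simp_all add: norm_unitization_def le_max_iff_disj)
    finally show ?thesis by (simp add: mult.assoc)
  qed
  then have "onorm (left_mult (X * Y)) \<le> norm X * norm Y"
    by (rule onorm_bound[rotated]) (simp add: norm_unitization_ge0)
  moreover have "cmod (scal (X * Y)) \<le> norm X * norm Y"
    by (simp add: unitization_ops norm_unitization_def norm_mult mult_mono le_max_iff_disj)
  ultimately show ?thesis
    by (subst norm_unitization_def) simp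
qed

lemma left_mult_scaleR: "left_mult (r *\<^sub>R X) y = r *\<^sub>R left_mult X y"
  by (simp add: left_mult_def unitization_ops scaleC_scaleC scaleR_scaleC
        scaleC_add_right mult_scaleC_left)

instance
proof
  fix X Y Z :: "'a unitization" and r s :: real and c d :: complex
  show "X + Y + Z = X + (Y + Z)" "X + Y = Y + X" "0 + X = X" "- X + X = 0" "X - Y = X + - Y"
    by (simp_all add: unitization_ops)
  show "r *\<^sub>R (X + Y) = r *\<^sub>R X + r *\<^sub>R Y" "(r + s) *\<^sub>R X = r *\<^sub>R X + s *\<^sub>R X"
    "r *\<^sub>R s *\<^sub>R X = (r * s) *\<^sub>R X" "1 *\<^sub>R X = X"
    by (simp_all add: unitization_ops algebra_simps)
  show "X * Y * Z = X * (Y * Z)" "(X + Y) * Z = X * Z + Y * Z" "X * (Y + Z) = X * Y + X * Z"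
    by (simp_all add: unitization_ops algebra_simps scaleC_add_left scaleC_add_right scaleC_scaleC
        mult_scaleC_left mult_scaleC_right)
  show "r *\<^sub>R X * Y = r *\<^sub>R (X * Y)" "X * r *\<^sub>R Y = r *\<^sub>R (X * Y)"
    by (simp_all add: unitization_ops algebra_simps scaleC_add_left scaleC_add_right scaleC_scaleC
        mult_scaleC_left mult_scaleC_right scaleR_scaleC)
  show "1 * X = X" "X * 1 = X" "0 \<noteq> (1::'a unitization)"
    by (simp_all add: unitization_ops scaleC_one)
  have "onorm (left_mult (r *\<^sub>R X)) = \<bar>r\<bar> * onorm (left_mult X)"
    using onorm_scaleR[OF bounded_linear_left_mult, of r X] by (simp add: left_mult_scaleR[abs_def])
  then show "norm (r *\<^sub>R X) = \<bar>r\<bar> * norm X"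
    by (simp add: norm_unitization_def max_mult_distrib_left) (simp add: unitization_ops norm_mult)
  show "norm (X * Y) \<le> norm X * norm Y" by (rule norm_unitization_mult_le)
  show "dist X Y = norm (X - Y)" "sgn X = inverse (norm X) *\<^sub>R X"
    by (simp_all add: dist_unitization_def sgn_unitization_def)
  show "uniformity = (INF e\<in>{0<..}. principal {(X, Y :: 'a unitization). dist X Y < e})"
    by (rule uniformity_unitization_def)
  show "open U = (\<forall>x\<in>U. eventually (\<lambda>(x', y). x' = x \<longrightarrow> y \<in> U) uniformity)"
    for U :: "'a unitization set" by (rule open_unitization_def)
  have left_mult_1: "left_mult 1 = (\<lambda>y::'a. y)"
    by (simp add: left_mult_def unitization_ops scaleC_one fun_eq_iff)
  \<comment> \<open>In the zero algebra the identity map has operator norm 0, so only the bound by 1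
    is used; the scalar part supplies the value 1.\<close>
  show "norm (1::'a unitization) = 1"
    using onorm_id_le[where 'a = 'a] by (simp add: norm_unitization_def left_mult_1) (simp add: unitization_ops)
  show "norm (X + Y) \<le> norm X + norm Y"
  proof -
    have "onorm (left_mult (X + Y)) \<le> onorm (left_mult X) + onorm (left_mult Y)"
      using onorm_triangle[OF bounded_linear_left_mult[of X] bounded_linear_left_mult[of Y]]
      by (simp add: left_mult_add[abs_def])
    moreover have "cmod (scal (X + Y)) \<le> cmod (scal X) + cmod (scal Y)"
      by (simp add: unitization_ops norm_triangle_ineq)
    ultimately show ?thesis unfolding norm_unitization_def by linarith
  qed
  show "norm X = 0 \<longleftrightarrow> X = 0"
  proof
    assume "norm X = 0"
    then have s: "scal X = 0" and "onorm (left_mult X) = 0"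
      using onorm_pos_le[OF bounded_linear_left_mult[of X]]
      unfolding norm_unitization_def by (auto simp: max_def split: if_splits)
    \<comment> \<open>The test vector \<open>cstar (alg X)\<close> turns a vanishing operator into a
      vanishing \<open>alg X * cstar (alg X)\<close>.\<close>
    then have "left_mult X (cstar (alg X)) = 0"
      using norm_left_mult_le[of X "cstar (alg X)"] by simp
    then have "alg X * cstar (alg X) = 0" using s by (simp add: left_mult_def)
    then have "alg X = 0" using norm_mult_cstar[of "alg X"] by simp
    then show "X = 0" using s by (cases X) (simp add: unitization_ops)
  next
    assume "X = 0"
    moreover have "left_mult 0 = (\<lambda>y::'a. 0)"
      by (simp add: left_mult_def unitization_ops fun_eq_iff)
    ultimately show "norm X = 0"
      by (simp add: norm_unitization_def onorm_zero) (simp add: unitization_ops)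
  qed
qed

end

lemma cmod_scal_le: "cmod (scal X) \<le> norm X"
  by (simp add: norm_unitization_def)

text \<open>Evaluating \<open>left_mult X\<close> at \<open>cstar (alg X)\<close> produces the
  square of \<open>norm (alg X)\<close> up to a scalar term. With \<open>norm_unitization_le\<close>
  and \<open>cmod_scal_le\<close> this makes convergence componentwise, hence completeness.\<close>

lemma norm_alg_le: "norm (alg X) \<le> 2 * norm X"
proof (cases "alg X = 0")
  case False
  have "norm (alg X) * norm (alg X) = norm (left_mult X (cstar (alg X)) - scaleC (scal X) (cstar (alg X)))"
    by (simp add: left_mult_def norm_mult_cstar)
  also have "\<dots> \<le> onorm (left_mult X) * norm (alg X) + cmod (scal X) * norm (alg X)"
    using norm_left_mult_le[of X "cstar (alg X)"]
    by (intro order_trans[OF norm_triangle_ineq4]) (simp add: norm_scaleC)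
  also have "\<dots> \<le> norm X * norm (alg X) + norm X * norm (alg X)"
    by (intro add_mono mult_right_mono) (simp_all add: norm_unitization_def)
  finally have "norm (alg X) * norm (alg X) \<le> (2 * norm X) * norm (alg X)" by simp
  then show ?thesis using False by simp
qed simp

lemma norm_unitization_le: "norm X \<le> norm (alg X) + cmod (scal X)"
proof -
  have "onorm (left_mult X) \<le> norm (alg X) + cmod (scal X)"
  proof (rule onorm_bound)
    fix y
    have "norm (left_mult X y) \<le> norm (alg X * y) + norm (scaleC (scal X) y)"
      unfolding left_mult_def by (rule norm_triangle_ineq)
    also have "\<dots> \<le> norm (alg X) * norm y + cmod (scal X) * norm y"
      by (simp add: norm_mult_ineq norm_scaleC)
    finally show "norm (left_mult X y) \<le> (norm (alg X) + cmod (scal X)) * norm y"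
      by (simp add: algebra_simps)
  qed simp
  then show ?thesis by (simp add: norm_unitization_def)
qed

lemma alg_diff: "alg (X - Y) = alg X - alg Y" and scal_diff: "scal (X - Y) = scal X - scal Y"
  by (simp_all add: unitization_ops)

instance unitization :: (cstar_algebra) banach
proof
  fix X :: "nat \<Rightarrow> 'a unitization"
  assume X: "Cauchy X"
  have "Cauchy (\<lambda>n. scal (X n))"
  proof (rule metric_CauchyI)
    fix e :: real assume "0 < e"
    then obtain M where M: "\<forall>m\<ge>M. \<forall>n\<ge>M. dist (X m) (X n) < e"
      using metric_CauchyD[OF X] by blast
    show "\<exists>M. \<forall>m\<ge>M. \<forall>n\<ge>M. dist (scal (X m)) (scal (X n)) < e"
      using M by (metis cmod_scal_le dist_norm le_less_trans scal_diff)
  qed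
  then obtain c where c: "(\<lambda>n. scal (X n)) \<longlonglongrightarrow> c"
    using Cauchy_convergent_iff convergent_def by blast
  have "Cauchy (\<lambda>n. alg (X n))"
  proof (rule metric_CauchyI)
    fix e :: real assume "0 < e"
    then obtain M where M: "\<forall>m\<ge>M. \<forall>n\<ge>M. dist (X m) (X n) < e / 2"
      using metric_CauchyD[OF X, of "e / 2"] by auto
    show "\<exists>M. \<forall>m\<ge>M. \<forall>n\<ge>M. dist (alg (X m)) (alg (X n)) < e"
    proof (intro exI allI impI)
      fix m n assume "M \<le> m" "M \<le> n"
      then have "norm (X m - X n) < e / 2" using M by (simp add: dist_norm)
      then show "dist (alg (X m)) (alg (X n)) < e"
        using norm_alg_le[of "X m - X n"] by (simp add: dist_norm alg_diff)
    qed
  qed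
  then obtain x where x: "(\<lambda>n. alg (X n)) \<longlonglongrightarrow> x"
    using Cauchy_convergent_iff convergent_def by blast
  have lim: "(\<lambda>n. norm (alg (X n) - x) + cmod (scal (X n) - c)) \<longlonglongrightarrow> 0"
    using c x by (intro tendsto_add_zero tendsto_norm_zero) (simp_all add: LIM_zero_iff)
  have "norm (X n - Unitization x c) \<le> norm (alg (X n) - x) + cmod (scal (X n) - c)" for n
    using norm_unitization_le[of "X n - Unitization x c"] by (simp add: alg_diff scal_diff)
  then have "(\<lambda>n. X n - Unitization x c) \<longlonglongrightarrow> 0"
    by (intro Lim_null_comparison[OF _ lim]) simp
  then have "X \<longlonglongrightarrow> Unitization x c" by (simp add: LIM_zero_iff)
  then show "convergent X" by (rule convergentI)
qed

section \<open>The C*-structure of the unitization\<close>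

instantiation unitization :: (cstar_algebra) cstar_algebra
begin

definition "scaleC c X = Unitization (scaleC c (alg X)) (c * scal X)"
definition "cstar X = Unitization (cstar (alg X)) (cnj (scal X))"

lemmas unitization_cstar_ops = unitization_ops scaleC_unitization_def cstar_unitization_def

lemma left_mult_scaleC: "left_mult (scaleC c X) y = scaleC c (left_mult X y)"
  by (simp add: left_mult_def unitization_cstar_ops scaleC_scaleC scaleC_add_right mult_scaleC_left)

text \<open>For the algebra-valued inner product \<open>cstar y * z\<close>, the adjoint of acting
  by \<open>X\<close> is acting by \<open>cstar X\<close>.\<close>

lemma cstar_left_mult_mult: "cstar (left_mult X y) * z = cstar y * left_mult (cstar X) z"
  by (simp add: left_mult_def unitization_cstar_ops cstar_add cstar_mult cstar_scaleC
        mult_scaleC_left mult_scaleC_right algebra_simps)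

text \<open>As for operators on a Hilbert space: the square of \<open>norm (left_mult X y)\<close>
  is the norm of the inner product of \<open>y\<close> with
  \<open>left_mult (cstar X * X) y\<close>.\<close>

lemma norm_unitization_square_le:
  "norm X * norm X \<le> norm (cstar X * (X::'a unitization))"
proof -
  have scal: "cmod (scal X) * cmod (scal X) \<le> norm (cstar X * X)"
    by (simp add: norm_unitization_def unitization_cstar_ops norm_mult)
  have bnd: "norm (left_mult X y) \<le> sqrt (norm (cstar X * X)) * norm y" for y
  proof -
    have "norm (left_mult X y) * norm (left_mult X y) = norm (cstar y * left_mult (cstar X * X) y)"
      by (simp add: left_mult_mult cstar_left_mult_mult flip: cstar_identity)
    also have "\<dots> \<le> norm y * (onorm (left_mult (cstar X * X)) * norm y)"
      by (rule order_trans[OF norm_mult_ineq]) (simp add: mult_left_mono norm_left_mult_le)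
    also have "\<dots> \<le> norm (cstar X * X) * (norm y)\<^sup>2"
      using mult_right_mono[of "onorm (left_mult (cstar X * X))" "norm (cstar X * X)" "norm y * norm y"]
      by (simp add: norm_unitization_def power2_eq_square mult_ac)
    finally have "(norm (left_mult X y))\<^sup>2 \<le> norm (cstar X * X) * (norm y)\<^sup>2"
      by (simp add: power2_eq_square)
    then have "norm (left_mult X y) \<le> sqrt (norm (cstar X * X) * (norm y)\<^sup>2)"
      by (rule real_le_rsqrt)
    then show ?thesis by (simp add: real_sqrt_mult)
  qed
  have "onorm (left_mult X) \<le> sqrt (norm (cstar X * X))"
    by (rule onorm_bound) (simp_all add: bnd)
  moreover have "cmod (scal X) \<le> sqrt (norm (cstar X * X))"
    using scal by (intro real_le_rsqrt) (simp add: power2_eq_square)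
  ultimately have "norm X \<le> sqrt (norm (cstar X * X))"
    by (simp add: norm_unitization_def)
  moreover have "0 \<le> norm X" "0 \<le> norm (cstar X * X)"
    by (simp_all add: norm_unitization_def le_max_iff_disj)
  ultimately have "(norm X)\<^sup>2 \<le> (sqrt (norm (cstar X * X)))\<^sup>2"
    by (intro power_mono)
  then show ?thesis using \<open>0 \<le> norm (cstar X * X)\<close> by (simp add: power2_eq_square)
qed

text \<open>The preceding inequality and submultiplicativity force the involution to be isometric,
  and then submultiplicativity gives the reverse inequality.\<close>

lemma norm_unitization_cstar_identity: "norm (cstar X * X) = norm X * norm (X::'a unitization)"
proof -
  have "norm Y \<le> norm (cstar Y)" for Y :: "'a unitization"
  proof (cases "norm Y = 0")
    case False
    have "norm Y * norm Y \<le> norm (cstar Y) * norm Y"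
      using norm_unitization_square_le[of Y] norm_unitization_mult_le[of "cstar Y" Y] by linarith
    then show ?thesis using False norm_unitization_ge0[of Y] by simp
  qed (simp add: norm_unitization_ge0)
  from this[of "cstar X"] have "norm (cstar X) \<le> norm X"
    by (simp add: unitization_cstar_ops cstar_cstar)
  then have "norm (cstar X * X) \<le> norm X * norm X"
    by (intro order_trans[OF norm_unitization_mult_le] mult_right_mono norm_unitization_ge0)
  then show ?thesis using norm_unitization_square_le[of X] by linarith
qed

lemma norm_unitization_scaleC: "norm (scaleC c X) = cmod c * norm (X::'a unitization)"
proof -
  have le: "norm (scaleC c X) \<le> cmod c * norm X" for c and X :: "'a unitization"
  proof -
    have "onorm (left_mult (scaleC c X)) \<le> cmod c * onorm (left_mult X)"
      by (rule onorm_bound) (simp_all add: left_mult_scaleC norm_scaleC norm_left_mult_le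
          mult_left_mono mult.assoc onorm_pos_le bounded_linear_left_mult)
    also have "\<dots> \<le> cmod c * norm X"
      by (simp add: norm_unitization_def mult_left_mono)
    finally have "onorm (left_mult (scaleC c X)) \<le> cmod c * norm X" .
    moreover have "cmod (scal (scaleC c X)) \<le> cmod c * norm X"
      by (simp add: norm_unitization_def unitization_cstar_ops norm_mult mult_left_mono)
    ultimately show ?thesis by (subst norm_unitization_def) simp
  qed
  show ?thesis
  proof (cases "c = 0")
    case True
    then show ?thesis using le[of 0 X] norm_unitization_ge0[of "scaleC 0 X"] by simp
  next
    case False
    have c: "cmod (inverse c) = inverse (cmod c)" "cmod c > 0"
      using False by (simp_all add: norm_inverse)
    have "scaleC (inverse c) (scaleC c X) = X"
      using False by (simp add: unitization_cstar_ops scaleC_scaleC scaleC_one flip: mult.assoc)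
    then have "norm X \<le> cmod (inverse c) * norm (scaleC c X)"
      using le[of "inverse c" "scaleC c X"] by simp
    then have "cmod c * norm X \<le> norm (scaleC c X)"
      using c by (simp add: field_simps)
    then show ?thesis using le[of c X] by linarith
  qed
qed

instance
proof
  fix X Y Z :: "'a unitization" and r s :: real and c d :: complex
  show "scaleR r X = scaleC (complex_of_real r) X" "scaleC c (X + Y) = scaleC c X + scaleC c Y"
    "scaleC (c + d) X = scaleC c X + scaleC d X" "scaleC c (scaleC d X) = scaleC (c * d) X"
    "scaleC 1 X = X" "scaleC c X * Y = scaleC c (X * Y)" "X * scaleC c Y = scaleC c (X * Y)"
    by (simp_all add: unitization_cstar_ops algebra_simps scaleC_add_left scaleC_add_right scaleC_scaleC
        mult_scaleC_left mult_scaleC_right scaleR_scaleC scaleC_one)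
  show "cstar (cstar X) = X" "cstar (X + Y) = cstar X + cstar Y"
    "cstar (scaleC c X) = scaleC (cnj c) (cstar X)" "cstar (X * Y) = cstar Y * cstar X"
    by (simp_all add: unitization_cstar_ops cstar_cstar cstar_add cstar_scaleC cstar_mult)
  show "norm (scaleC c X) = cmod c * norm X" by (rule norm_unitization_scaleC)
  show "norm (cstar X * X) = norm X * norm X" by (rule norm_unitization_cstar_identity)
qed

end

class unital_cstar_algebra = cstar_algebra + real_normed_algebra_1

instance unitization :: (cstar_algebra) unital_cstar_algebra ..

section \<open>Invertible elements and spectra of self-adjoint elements\<close>

definition inverses :: "'a::monoid_mult \<Rightarrow> 'a \<Rightarrow> bool" where
  "inverses x y \<longleftrightarrow> x * y = 1 \<and> y * x = 1"

definition unit_element :: "'a::monoid_mult \<Rightarrow> bool" where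
  "unit_element x \<longleftrightarrow> (\<exists>y. inverses x y)"

lemma inversesI: "x * y = 1 \<Longrightarrow> y * x = 1 \<Longrightarrow> inverses x y"
  by (simp add: inverses_def)

lemma inverses_cancel:
  assumes "inverses x y"
  shows "x * y = 1" "y * x = 1" "x * (y * z) = z" "y * (x * z) = z"
  using assms by (simp_all add: inverses_def flip: mult.assoc)

lemma inverses_sym: "inverses x y \<longleftrightarrow> inverses y x"
  by (auto simp: inverses_def)

lemma unit_elementI: "inverses x y \<Longrightarrow> unit_element x"
  by (auto simp: unit_element_def)

lemma unit_element_one: "unit_element 1"
  by (rule unit_elementI[of _ 1]) (simp add: inverses_def)

lemma unit_element_mult:
  assumes "unit_element x" "unit_element y" shows "unit_element (x * y)"
proof -
  obtain x' y' where "inverses x x'" "inverses y y'"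
    using assms by (auto simp: unit_element_def)
  then have "inverses (x * y) (y' * x')"
    by (auto intro!: inversesI simp: mult.assoc inverses_cancel)
  then show ?thesis by (rule unit_elementI)
qed

lemma unit_element_scaleC:
  fixes x :: "'a::unital_cstar_algebra"
  assumes "unit_element x" "c \<noteq> 0" shows "unit_element (scaleC c x)"
proof -
  obtain y where "inverses x y" using assms(1) by (auto simp: unit_element_def)
  then have "inverses (scaleC c x) (scaleC (inverse c) y)"
    using assms(2)
    by (auto simp: inverses_def mult_scaleC_left mult_scaleC_right scaleC_scaleC scaleC_one)
  then show ?thesis by (rule unit_elementI)
qed

lemma unit_element_scaleR:
  fixes x :: "'a::unital_cstar_algebra"
  assumes "unit_element x" "c \<noteq> 0" shows "unit_element (c *\<^sub>R x)"
  using unit_element_scaleC[OF assms(1), of "complex_of_real c"] assms(2) by (simp add: scaleR_scaleC)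

lemma unit_element_minus:
  fixes x :: "'a::unital_cstar_algebra"
  assumes "unit_element x" shows "unit_element (- x)"
  using unit_element_scaleR[OF assms, of "-1"] by simp

text \<open>If \<open>z\<close> inverts \<open>1 + x * y\<close>, then \<open>1 - y * z * x\<close>
  inverts \<open>1 + y * x\<close>.\<close>

lemma unit_element_one_plus_swap:
  fixes x y :: "'a::ring_1"
  assumes "unit_element (1 + x * y)" shows "unit_element (1 + y * x)"
proof -
  obtain z where z: "inverses (1 + x * y) z"
    using assms by (auto simp: unit_element_def)
  have 1: "x * y * z = 1 - z" "z * x * y = 1 - z"
    using z by (auto simp: inverses_def algebra_simps)
  have "(1 + y * x) * (1 - y * z * x) = 1 + y * x - y * z * x - y * (x * y * z) * x"
    by (simp add: algebra_simps)
  also have "\<dots> = 1" unfolding 1 by (simp add: algebra_simps)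
  finally have r: "(1 + y * x) * (1 - y * z * x) = 1" .
  have "(1 - y * z * x) * (1 + y * x) = 1 + y * x - y * z * x - y * (z * x * y) * x"
    by (simp add: algebra_simps)
  also have "\<dots> = 1" unfolding 1 by (simp add: algebra_simps)
  finally have "(1 - y * z * x) * (1 + y * x) = 1" .
  with r show ?thesis by (intro unit_elementI[OF inversesI])
qed

text \<open>The Neumann series is the inverse.\<close>

lemma unit_element_one_minus:
  fixes x :: "'a::unital_cstar_algebra"
  assumes "norm x < 1" shows "unit_element (1 - x)"
proof -
  have "summable (\<lambda>n. norm (x ^ n))"
    by (rule summable_comparison_test'[where g = "\<lambda>n. norm x ^ n" and N = 0])
      (simp_all add: assms norm_power_ineq summable_geometric)
  then have sm: "summable (\<lambda>n. x ^ n)" by (rule summable_norm_cancel)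
  let ?S = "\<Sum>n. x ^ n"
  have "x * ?S = ?S - 1" "?S * x = ?S - 1"
    using suminf_split_head[OF sm] suminf_mult[OF sm, of x] suminf_mult2[OF sm, of x]
    by (simp_all add: power_commutes)
  then show ?thesis
    by (intro unit_elementI[of _ ?S] inversesI) (simp_all add: algebra_simps)
qed

lemma unit_element_scaleC_minus:
  fixes x :: "'a::unital_cstar_algebra"
  assumes "norm x < cmod c" shows "unit_element (scaleC c 1 - x)"
proof -
  have c: "c \<noteq> 0" using assms norm_ge_zero[of x] by auto
  have "norm (scaleC (inverse c) x) < 1"
    using assms c by (simp add: norm_scaleC norm_inverse field_simps norm_divide)
  then have "unit_element (scaleC c (1 - scaleC (inverse c) x))"
    using c by (intro unit_element_scaleC unit_element_one_minus)
  then show ?thesis using c by (simp add: scaleC_diff_right scaleC_scaleC scaleC_one)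
qed

lemma unit_element_scaleR_minus:
  fixes x :: "'a::unital_cstar_algebra"
  assumes "norm x < t" shows "unit_element (t *\<^sub>R 1 - x)"
  using unit_element_scaleC_minus[of x "complex_of_real t"] assms by (simp add: scaleR_scaleC)

lemma cstar_one [simp]: "cstar (1::'a::unital_cstar_algebra) = 1"
  by (metis cstar_cstar cstar_mult mult.left_neutral mult.right_neutral)

lemma cstar_power: "cstar (x ^ n) = cstar (x::'a::unital_cstar_algebra) ^ n"
  by (induction n) (simp_all add: cstar_mult power_commutes)

section \<open>Norm and spectrum of self-adjoint elements\<close>

lemma norm_selfadjoint_square: "cstar x = x \<Longrightarrow> norm (x * x) = norm x * norm (x::'a::cstar_algebra)"
  using cstar_identity[of x] by simp

lemma norm_selfadjoint_power_two_power:
  fixes x :: "'a::unital_cstar_algebra"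
  assumes "cstar x = x" shows "norm (x ^ 2 ^ k) = norm x ^ 2 ^ k"
proof (induction k)
  case (Suc k)
  have "x ^ 2 ^ Suc k = x ^ 2 ^ k * x ^ 2 ^ k" by (simp add: mult_2 power_add)
  then show ?case
    using norm_selfadjoint_square[of "x ^ 2 ^ k"] Suc assms
    by (simp add: cstar_power mult_2 power_add)
qed simp

text \<open>Arens' trick: a shift by \<open>\<i> * \<tau>\<close> raises the squared norm of the
  self-adjoint \<open>k\<close> by at most the square of \<open>\<tau>\<close>, while the squared
  distance of the shifted spectral point from 0 also gains a cross term. For suitable
  \<open>\<tau>\<close> that point lies outside the ball of radius \<open>norm X\<close>.\<close>

lemma unit_element_selfadjoint_minus_nonreal:
  fixes h :: "'a::unital_cstar_algebra"
  assumes h: "cstar h = h" and z: "Im z \<noteq> 0"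
  shows "unit_element (h - scaleC z 1)"
proof -
  define k where "k = h - Re z *\<^sub>R 1"
  \<comment> \<open>Chosen so that the cross term \<open>2 * \<tau> * Im z\<close> equals the square
    of \<open>norm k\<close>; the square of \<open>Im z\<close> remains as strict surplus.\<close>
  define \<tau> where "\<tau> = (norm k)\<^sup>2 / (2 * Im z)"
  define X where "X = k + scaleC (\<i> * \<tau>) 1"
  have k: "cstar k = k" by (simp add: k_def cstar_diff cstar_scaleR h)
  have cX: "cstar X = k - scaleC (\<i> * \<tau>) 1"
    by (simp add: X_def cstar_add cstar_scaleC k scaleC_minus_left)
  have "cstar X * X = k * k + \<tau>\<^sup>2 *\<^sub>R 1"
    unfolding cX unfolding X_def
    by (simp add: algebra_simps mult_scaleC_left mult_scaleC_right scaleC_diff_right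
        scaleC_scaleC scaleC_minus_left scaleR_scaleC power2_eq_square)
  then have "(norm X)\<^sup>2 \<le> (norm k)\<^sup>2 + \<tau>\<^sup>2"
    using norm_triangle_ineq[of "k * k" "\<tau>\<^sup>2 *\<^sub>R 1"]
    by (simp add: power2_eq_square norm_selfadjoint_square[OF k] flip: cstar_identity)
  also have "\<dots> < (\<tau> + Im z)\<^sup>2"
    using z by (simp add: power2_sum \<tau>_def)
  finally have "norm X < \<bar>\<tau> + Im z\<bar>"
    using power2_less_imp_less[of "norm X" "\<bar>\<tau> + Im z\<bar>"] by simp
  also have "\<bar>\<tau> + Im z\<bar> = cmod (\<i> * (\<tau> + Im z))"
    by (simp add: norm_mult flip: of_real_add)
  finally have "norm X < cmod (\<i> * (\<tau> + Im z))" .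
  then have "unit_element (scaleC (\<i> * (\<tau> + Im z)) 1 - X)"
    by (rule unit_element_scaleC_minus)
  then have "unit_element (- (scaleC (\<i> * (\<tau> + Im z)) 1 - X))"
    by (rule unit_element_minus)
  also have "- (scaleC (\<i> * (\<tau> + Im z)) 1 - X) = h - scaleC (Re z + \<i> * Im z) 1"
    by (simp add: X_def k_def scaleR_scaleC algebra_simps scaleC_add_left)
  finally show ?thesis by (simp flip: complex_eq)
qed

lemma scaleC_power: "scaleC c x ^ n = scaleC (c ^ n) (x ^ n :: 'a::unital_cstar_algebra)"
  by (induction n) (simp_all add: mult_scaleC_left mult_scaleC_right scaleC_scaleC scaleC_one
      mult.commute)

lemma norm_inverses_le:
  fixes q y :: "'a::unital_cstar_algebra"
  assumes "inverses y q" "norm (q - 1) \<le> e" "e < 1"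
  shows "norm y \<le> 1 / (1 - e)"
proof -
  have "y = 1 - (q - 1) * y" using assms(1) by (simp add: inverses_def algebra_simps)
  then have "norm y \<le> 1 + norm ((q - 1) * y)"
    using norm_triangle_ineq4[of 1 "(q - 1) * y"] by simp
  also have "\<dots> \<le> 1 + e * norm y"
    using norm_mult_ineq[of "q - 1" y] mult_right_mono[OF assms(2), of "norm y"] by simp
  finally show ?thesis using assms(3) by (simp add: field_simps)
qed

text \<open>The resolvent identity bounds \<open>R z - R w\<close> by a multiple of
  \<open>norm (R z)\<close>. Near \<open>w\<close> that factor is at most
  \<open>2 * norm (R w)\<close>, by absorbing half of it.\<close>

lemma continuous_on_inverses:
  fixes R :: "complex \<Rightarrow> 'a::unital_cstar_algebra"
  assumes R: "\<And>z. z \<in> D \<Longrightarrow> inverses (1 - scaleC z h) (R z)"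
  shows "continuous_on D R"
proof -
  have id: "R z - R w = scaleC (z - w) (R z * h * R w)" if "z \<in> D" "w \<in> D" for z w
  proof -
    have "R z - R w = R z * ((1 - scaleC w h) * R w) - (R z * (1 - scaleC z h)) * R w"
      using R[OF that(1)] R[OF that(2)] by (simp add: inverses_def)
    also have "\<dots> = scaleC (z - w) (R z * h * R w)"
      by (simp add: scaleC_diff_left mult_scaleC_left mult_scaleC_right algebra_simps)
    finally show ?thesis .
  qed
  show ?thesis
    unfolding continuous_on_def
  proof
    fix w assume w: "w \<in> D"
    define M where "M = norm h * norm (R w)"
    have M: "0 \<le> M" by (simp add: M_def)
    have est: "norm (R z - R w) \<le> cmod (z - w) * (norm (R z) * M)" if "z \<in> D" for z
    proof -
      have "norm (R z * h * R w) \<le> norm (R z) * M"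
        by (metis M_def mult.assoc mult_left_mono norm_ge_zero norm_mult_ineq order_trans)
      then show ?thesis by (simp add: id[OF that w] norm_scaleC mult_left_mono)
    qed
    have bnd: "norm (R z - R w) \<le> cmod (z - w) * (2 * norm (R w) * M)"
      if z: "z \<in> D" "cmod (z - w) * M < 1 / 2" for z
    proof -
      have "norm (R z) \<le> norm (R w) + norm (R z - R w)"
        using norm_triangle_sub by blast
      also have "\<dots> \<le> norm (R w) + (1 / 2) * norm (R z)"
        using est[OF z(1)] mult_right_mono[OF less_imp_le[OF z(2)], of "norm (R z)"]
        by (simp add: mult_ac)
      finally have "norm (R z) * M \<le> 2 * norm (R w) * M"
        using M by (intro mult_right_mono) auto
      then show ?thesis
        using est[OF z(1)] mult_left_mono[of "norm (R z) * M" "2 * norm (R w) * M" "cmod (z - w)"]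
        by simp
    qed
    have "((\<lambda>z. cmod (z - w) * M) \<longlongrightarrow> cmod (w - w) * M) (at w within D)"
      by (intro tendsto_intros)
    then have "\<forall>\<^sub>F z in at w within D. cmod (z - w) * M < 1 / 2"
      by (rule order_tendstoD) simp
    then have ev: "\<forall>\<^sub>F z in at w within D. norm (R z - R w) \<le> cmod (z - w) * (2 * norm (R w) * M)"
      using bnd by (auto simp: eventually_at_filter elim: eventually_mono)
    have "((\<lambda>z. cmod (z - w) * (2 * norm (R w) * M)) \<longlongrightarrow> cmod (w - w) * (2 * norm (R w) * M))
        (at w within D)"
      by (intro tendsto_intros)
    then have "((\<lambda>z. R z - R w) \<longlongrightarrow> 0) (at w within D)"
      by (intro Lim_null_comparison[OF ev]) simp
    then show "(R \<longlongrightarrow> R w) (at w within D)" by (simp add: LIM_zero_iff)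
  qed
qed

text \<open>With \<open>n = 2 ^ k\<close>, the inverse of \<open>1 - (z h) ^ n\<close> is the average of the inverses of
  \<open>1 - \<omega> z h\<close> over the \<open>n\<close>-th roots of unity \<open>\<omega>\<close>, so it inherits the modulus of continuity of the
  resolvent uniformly in \<open>n\<close>.\<close>

lemma equicontinuous_inverses_two_power:
  fixes R :: "complex \<Rightarrow> 'a::unital_cstar_algebra"
  assumes R: "\<And>z. cmod z \<le> \<sigma> \<Longrightarrow> inverses (1 - scaleC z h) (R z)"
    and equi: "\<And>z w. cmod z \<le> \<sigma> \<Longrightarrow> cmod w \<le> \<sigma> \<Longrightarrow> cmod (z - w) < \<delta> \<Longrightarrow> norm (R z - R w) \<le> e"
  shows "\<exists>S. (\<forall>z. cmod z \<le> \<sigma> \<longrightarrow> inverses (1 - scaleC z h ^ 2 ^ k) (S z)) \<and>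
    (\<forall>z w. cmod z \<le> \<sigma> \<longrightarrow> cmod w \<le> \<sigma> \<longrightarrow> cmod (z - w) < \<delta> \<longrightarrow> norm (S z - S w) \<le> e)"
proof (induction k)
  case 0
  then show ?case using R equi by (intro exI[of _ R]) simp
next
  case (Suc k)
  then obtain S where S: "\<And>z. cmod z \<le> \<sigma> \<Longrightarrow> inverses (1 - scaleC z h ^ 2 ^ k) (S z)"
    and equiS: "\<And>z w. cmod z \<le> \<sigma> \<Longrightarrow> cmod w \<le> \<sigma> \<Longrightarrow> cmod (z - w) < \<delta> \<Longrightarrow> norm (S z - S w) \<le> e"
    by blast
  \<comment> \<open>A \<open>2 ^ k\<close>-th root of -1: replacing \<open>z\<close> by
    \<open>\<omega> * z\<close> changes the sign of \<open>Y\<close>, and the inverse of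
    \<open>1 - Y * Y\<close> is the mean of those of \<open>1 - Y\<close> and
    \<open>1 + Y\<close>.\<close>
  define \<omega> where "\<omega> = cis (pi / 2 ^ k)"
  have \<omega>: "\<omega> ^ 2 ^ k = -1" "cmod \<omega> = 1"
    unfolding \<omega>_def by (simp_all add: Complex.DeMoivre)
  define T where "T z = (1 / 2) *\<^sub>R (S z + S (\<omega> * z))" for z
  have "inverses (1 - scaleC z h ^ 2 ^ Suc k) (T z)" if z: "cmod z \<le> \<sigma>" for z
  proof -
    define Y where "Y = scaleC z h ^ 2 ^ k"
    have Y: "scaleC (\<omega> * z) h ^ 2 ^ k = - Y"
      by (simp add: Y_def scaleC_power power_mult_distrib \<omega> scaleC_minus_left)
    have 1: "(1 - Y) * S z = 1" "S z * (1 - Y) = 1"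
      using S[OF z] by (simp_all add: inverses_def Y_def)
    have 2: "(1 + Y) * S (\<omega> * z) = 1" "S (\<omega> * z) * (1 + Y) = 1"
      using S[of "\<omega> * z"] z by (simp_all add: inverses_def Y norm_mult \<omega>)
    have sq: "1 - scaleC z h ^ 2 ^ Suc k = (1 + Y) * (1 - Y)" "(1 + Y) * (1 - Y) = (1 - Y) * (1 + Y)"
      by (simp_all add: Y_def mult_2 power_add algebra_simps)
    have "(1 + Y) * (1 - Y) * (S z + S (\<omega> * z)) = (1 + Y) * (1 - Y) * S z + (1 - Y) * (1 + Y) * S (\<omega> * z)"
      unfolding distrib_left[of "(1 + Y) * (1 - Y)"] by (subst (2) sq(2)) (rule refl)
    also have "\<dots> = 2" unfolding mult.assoc 1 2 by simp
    finally have l: "(1 + Y) * (1 - Y) * (S z + S (\<omega> * z)) = 2" .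
    have "(S z + S (\<omega> * z)) * ((1 + Y) * (1 - Y)) = S z * ((1 - Y) * (1 + Y)) + S (\<omega> * z) * ((1 + Y) * (1 - Y))"
      unfolding distrib_right[of "S z"] by (subst (1) sq(2)) (rule refl)
    also have "\<dots> = 2" unfolding mult.assoc[symmetric] 1 2 by simp
    finally have r: "(S z + S (\<omega> * z)) * ((1 + Y) * (1 - Y)) = 2" .
    have half: "(1 / 2) *\<^sub>R (2::'a) = 1"
      by (metis scaleR_half_double one_add_one)
    show ?thesis
      unfolding sq(1) T_def by (rule inversesI) (simp_all only: mult_scaleR_left mult_scaleR_right l r half)
  qed
  moreover have "norm (T z - T w) \<le> e" if "cmod z \<le> \<sigma>" "cmod w \<le> \<sigma>" "cmod (z - w) < \<delta>" for z w
  proof -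
    have 1: "norm (S z - S w) \<le> e" using that by (rule equiS)
    have 2: "norm (S (\<omega> * z) - S (\<omega> * w)) \<le> e"
      using that by (intro equiS) (simp_all add: norm_mult \<omega> flip: right_diff_distrib)
    have "T z - T w = (1 / 2) *\<^sub>R ((S z - S w) + (S (\<omega> * z) - S (\<omega> * w)))"
      by (simp add: T_def algebra_simps)
    then have "norm (T z - T w) = norm ((S z - S w) + (S (\<omega> * z) - S (\<omega> * w))) / 2" by simp
    also have "\<dots> \<le> e" using norm_triangle_ineq[of "S z - S w" "S (\<omega> * z) - S (\<omega> * w)"] 1 2 by simp
    finally show ?thesis .
  qed
  ultimately show ?case by blast
qed

text \<open>Otherwise resolvents exist on a disc reaching beyond the radius
  \<open>1 / norm h\<close>. The powers \<open>(z h) ^ 2 ^ k\<close> have norm tending to 0 just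
  inside that radius and to infinity just outside it, yet the averaged resolvents at the two points
  stay close for every \<open>k\<close>.\<close>

lemma norm_selfadjoint_le_spectral_bound:
  fixes h :: "'a::unital_cstar_algebra"
  assumes h: "cstar h = h" and s: "0 \<le> s"
    and unit: "\<And>t. s < \<bar>t\<bar> \<Longrightarrow> unit_element (h - t *\<^sub>R 1)"
  shows "norm h \<le> s"
proof (rule ccontr)
  assume "\<not> norm h \<le> s"
  then have \<rho>: "s < norm h" "0 < norm h" using s by linarith+
  \<comment> \<open>The reciprocal of the midpoint of \<open>s\<close> and \<open>norm h\<close>:
    beyond \<open>1 / norm h\<close>, but still with \<open>\<sigma> * s < 1\<close>.\<close>
  define \<sigma> where "\<sigma> = 2 / (s + norm h)"
  have \<sigma>: "0 < \<sigma>" "1 / norm h < \<sigma>" "\<sigma> * s < 1"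
    using \<rho> s by (simp_all add: \<sigma>_def field_simps add_pos_nonneg)
  have "unit_element (1 - scaleC z h)" if z: "cmod z \<le> \<sigma>" for z
  proof (cases "z = 0")
    case True
    then show ?thesis by (simp add: unit_element_one)
  next
    case False
    have "unit_element (h - scaleC (inverse z) 1)"
    proof (cases "Im (inverse z) = 0")
      case True
      then have e: "inverse z = complex_of_real (Re (inverse z))" by (simp add: complex_eq_iff)
      have "s < cmod (inverse z)"
      proof -
        have "s * cmod z \<le> \<sigma> * s" using mult_right_mono[OF z s] by (simp add: mult.commute)
        then have "s * cmod z < 1" using \<sigma> by simp
        moreover have "cmod (inverse z) = 1 / cmod z" "0 < cmod z"
          using False by (simp_all add: norm_inverse inverse_eq_divide norm_divide)
        ultimately show ?thesis by (simp only: pos_less_divide_eq)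
      qed
      then have "s < \<bar>Re (inverse z)\<bar>" using e by (metis norm_of_real)
      then have "unit_element (h - Re (inverse z) *\<^sub>R 1)" by (rule unit)
      then show ?thesis using e by (simp add: scaleR_scaleC)
    next
      case False
      then show ?thesis by (rule unit_element_selfadjoint_minus_nonreal[OF h])
    qed
    then have "unit_element (scaleC (- z) (h - scaleC (inverse z) 1))"
      using False by (intro unit_element_scaleC) simp_all
    then show ?thesis
      using False by (simp add: scaleC_diff_right scaleC_scaleC scaleC_minus_left scaleC_one)
  qed
  then have "\<exists>y. inverses (1 - scaleC z h) y" if "cmod z \<le> \<sigma>" for z
    using that by (simp add: unit_element_def)
  then obtain R where R: "\<And>z. cmod z \<le> \<sigma> \<Longrightarrow> inverses (1 - scaleC z h) (R z)" by metis
  have "uniformly_continuous_on (cball 0 \<sigma>) R"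
    by (intro compact_uniformly_continuous continuous_on_inverses[of _ h] R) simp_all
  then obtain \<delta> where \<delta>: "0 < \<delta>"
    and equi: "\<And>z w. cmod z \<le> \<sigma> \<Longrightarrow> cmod w \<le> \<sigma> \<Longrightarrow> cmod (z - w) < \<delta> \<Longrightarrow> norm (R z - R w) \<le> 1/4"
    unfolding uniformly_continuous_on_def
    by (metis dist_norm less_imp_le mem_cball_0 zero_less_divide_1_iff zero_less_numeral)
  define r where "r = 1 / norm h"
  have r: "0 < r" "r < \<sigma>" "r * norm h = 1" using \<rho> s \<sigma> by (simp_all add: r_def)
  \<comment> \<open>At the radius \<open>r\<close> the element \<open>z h\<close> has norm 1. The
    points \<open>z1\<close> and \<open>z2\<close> straddle \<open>r\<close>, stay in the disc of
    radius \<open>\<sigma>\<close>, and are closer to each other than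
    \<open>\<delta>\<close>.\<close>
  define d where "d = min (min (r / 2) (\<sigma> - r)) (\<delta> / 3)"
  have d: "0 < d" "d < r" "r + d \<le> \<sigma>" "2 * d < \<delta>" using r \<delta> by (auto simp: d_def min_def)
  define z1 z2 where "z1 = r - d" and "z2 = r + d"
  have z1: "0 \<le> z1 * norm h" "z1 * norm h < 1" and z2: "1 < z2 * norm h"
    using d r(3) \<rho> mult_strict_right_mono[of z1 r "norm h"] mult_strict_right_mono[of r z2 "norm h"]
    by (simp_all add: z1_def z2_def)
  obtain m where m: "(z1 * norm h) ^ m < 1/8"
    using real_arch_pow_inv[of "1/8" "z1 * norm h"] z1 by auto
  obtain n where n: "3 < (z2 * norm h) ^ n"
    using real_arch_pow[OF z2] by blast
  define k where "k = max m n"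
  have "m \<le> k" "n \<le> k" by (simp_all add: k_def)
  then have "m \<le> 2 ^ k" "n \<le> 2 ^ k"
    using less_exp[of k] by linarith+
  then have "(z1 * norm h) ^ 2 ^ k \<le> (z1 * norm h) ^ m" "(z2 * norm h) ^ n \<le> (z2 * norm h) ^ 2 ^ k"
    using z1 z2 by (auto intro: power_decreasing power_increasing)
  then have k: "(z1 * norm h) ^ 2 ^ k < 1/8" "3 < (z2 * norm h) ^ 2 ^ k"
    using m n by linarith+
  have nrm: "norm (scaleC (complex_of_real z) h ^ 2 ^ k) = (z * norm h) ^ 2 ^ k" if "0 \<le> z" for z
    using that norm_selfadjoint_power_two_power[of "scaleC (complex_of_real z) h" k]
    by (simp add: cstar_scaleC h norm_scaleC)
  obtain S where S: "\<And>z. cmod z \<le> \<sigma> \<Longrightarrow> inverses (1 - scaleC z h ^ 2 ^ k) (S z)"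
    and equiS: "\<And>z w. cmod z \<le> \<sigma> \<Longrightarrow> cmod w \<le> \<sigma> \<Longrightarrow> cmod (z - w) < \<delta> \<Longrightarrow> norm (S z - S w) \<le> 1/4"
    using equicontinuous_inverses_two_power[of \<sigma> h R \<delta> "1/4" k, OF R equi] by blast
  have z12: "0 \<le> z1" "z1 \<le> \<sigma>" "0 \<le> z2" "z2 \<le> \<sigma>" "\<bar>z2 - z1\<bar> < \<delta>"
    using d by (simp_all add: z1_def z2_def)
  define Y1 Y2 where "Y1 = scaleC (complex_of_real z1) h ^ 2 ^ k" and "Y2 = scaleC (complex_of_real z2) h ^ 2 ^ k"
  have I: "inverses (1 - Y1) (S z1)" "inverses (1 - Y2) (S z2)"
    unfolding Y1_def Y2_def using z12 by (auto intro!: S)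
  have nY: "norm Y1 \<le> 1/8" "3 < norm Y2"
    unfolding Y1_def Y2_def using k z12 by (simp_all add: nrm)
  have S1: "norm (S z1) \<le> 8/7"
    using norm_inverses_le[of "S z1" "1 - Y1" "1/8"] I(1) nY(1) by (simp add: inverses_sym)
  have "S z1 - 1 = S z1 * Y1" using I(1) by (simp add: inverses_def algebra_simps)
  then have "norm (S z1 - 1) \<le> norm (S z1) * norm Y1" by (simp add: norm_mult_ineq)
  also have "\<dots> \<le> 8/7 * (1/8)" using S1 nY by (intro mult_mono) auto
  finally have "norm (S z1 - 1) \<le> 1/7" by simp
  moreover have "norm (S z2 - S z1) \<le> 1/4"
    using z12 by (intro equiS) (simp_all flip: of_real_diff)
  moreover have "norm (S z2 - 1) \<le> norm (S z2 - S z1) + norm (S z1 - 1)"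
    using norm_triangle_ineq[of "S z2 - S z1" "S z1 - 1"] by simp
  \<comment> \<open>Here 1/4 + 1/7 is below 1/2, so \<open>1 - Y2\<close>, inverse to an element
    within 1/2 of the unit, has norm at most 2. This caps \<open>norm Y2\<close> at 3, against the
    choice of \<open>n\<close>.\<close>
  ultimately have "norm (S z2 - 1) \<le> 1/2" by simp
  then have "norm (1 - Y2) \<le> 2"
    using norm_inverses_le[OF I(2), of "1/2"] by simp
  moreover have "norm Y2 \<le> norm (1 - Y2) + 1"
    using norm_triangle_ineq4[of 1 "1 - Y2"] by simp
  ultimately show False using nY by simp
qed

section \<open>Positive elements of a unital C*-algebra\<close>

text \<open>Only negative real points are excluded from the spectrum; self-adjointness already rules
  out the nonreal ones.\<close>

definition pos_element :: "'a::unital_cstar_algebra \<Rightarrow> bool" where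
  "pos_element x \<longleftrightarrow> cstar x = x \<and> (\<forall>t>0. unit_element (x + t *\<^sub>R 1))"

lemma pos_element_selfadjoint: "pos_element x \<Longrightarrow> cstar x = x"
  by (simp add: pos_element_def)

lemma pos_elementD: "pos_element x \<Longrightarrow> 0 < t \<Longrightarrow> unit_element (x + t *\<^sub>R 1)"
  by (simp add: pos_element_def)

text \<open>Write \<open>x + s\<close> as \<open>(s + t) - (t - x)\<close> and use the Neumann
  series. With the converse \<open>pos_element_norm_le\<close>, positivity becomes a norm condition,
  so that closure under sums is the triangle inequality.\<close>

lemma pos_elementI:
  assumes "cstar x = x" "norm (t *\<^sub>R 1 - x) \<le> t" shows "pos_element x"
  unfolding pos_element_def
proof (intro conjI allI impI)
  fix s :: real assume "0 < s"
  then have "unit_element ((s + t) *\<^sub>R 1 - (t *\<^sub>R 1 - x))"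
    using assms(2) by (intro unit_element_scaleR_minus) simp
  then show "unit_element (x + s *\<^sub>R 1)" by (simp add: algebra_simps)
qed (rule assms(1))

text \<open>An application of the spectral norm bound to \<open>t - x\<close>: points above
  \<open>t\<close> are excluded by positivity of \<open>x\<close>, points below \<open>- t\<close>
  by its norm.\<close>

lemma pos_element_norm_le:
  assumes x: "pos_element x" and t: "norm x \<le> t"
  shows "norm (t *\<^sub>R 1 - x) \<le> t"
proof (rule norm_selfadjoint_le_spectral_bound)
  have t0: "0 \<le> t" using t norm_ge_zero[of x] by linarith
  show "0 \<le> t" by (fact t0)
  show "cstar (t *\<^sub>R 1 - x) = t *\<^sub>R 1 - x"
    using x by (simp add: pos_element_def cstar_diff cstar_scaleR)
  fix s :: real assume s: "t < \<bar>s\<bar>"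
  show "unit_element (t *\<^sub>R 1 - x - s *\<^sub>R 1)"
  proof (cases "s > 0")
    case True
    then have "unit_element (- (x + (s - t) *\<^sub>R 1))"
      using s x by (intro unit_element_minus pos_elementD) simp_all
    then show ?thesis by (simp add: algebra_simps)
  next
    case False
    then have "unit_element ((t - s) *\<^sub>R 1 - x)"
      using s t t0 by (intro unit_element_scaleR_minus) simp
    then show ?thesis by (simp add: algebra_simps)
  qed
qed

lemma pos_element_add:
  assumes x: "pos_element x" and y: "pos_element y" shows "pos_element (x + y)"
proof (rule pos_elementI)
  show "cstar (x + y) = x + y" using x y by (simp add: cstar_add pos_element_def)
  show "norm ((norm x + norm y) *\<^sub>R 1 - (x + y)) \<le> norm x + norm y"
    using norm_triangle_ineq[of "norm x *\<^sub>R 1 - x" "norm y *\<^sub>R 1 - y"]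
      pos_element_norm_le[OF x order_refl] pos_element_norm_le[OF y order_refl]
    by (simp add: algebra_simps)
qed

lemma pos_element_zero: "pos_element 0"
  by (rule pos_elementI[where t = 0]) simp_all

lemma pos_element_scaleR:
  assumes x: "pos_element x" and c: "0 \<le> c" shows "pos_element (c *\<^sub>R x)"
proof (rule pos_elementI)
  show "cstar (c *\<^sub>R x) = c *\<^sub>R x" using x by (simp add: cstar_scaleR pos_element_def)
  have "norm ((c * norm x) *\<^sub>R 1 - c *\<^sub>R x) = c * norm (norm x *\<^sub>R 1 - x)"
    using c by (simp flip: scaleR_scaleR scaleR_right_diff_distrib)
  also have "\<dots> \<le> c * norm x"
    using c pos_element_norm_le[OF x order_refl] by (rule mult_left_mono[rotated])
  finally show "norm ((c * norm x) *\<^sub>R 1 - c *\<^sub>R x) \<le> c * norm x" .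
qed

lemma pos_element_norm_minus:
  assumes "cstar h = h" "norm h \<le> t" shows "pos_element (t *\<^sub>R 1 - h)"
  by (rule pos_elementI[where t = t]) (use assms in \<open>simp_all add: cstar_diff cstar_scaleR\<close>)

lemma pos_element_norm_plus:
  assumes "cstar h = h" "norm h \<le> t" shows "pos_element (h + t *\<^sub>R 1)"
  using pos_element_norm_minus[of "- h" t] assms by (simp add: cstar_minus add.commute)

lemma pos_element_limit:
  assumes "\<And>e. 0 < e \<Longrightarrow> pos_element (x + e *\<^sub>R 1)" shows "pos_element x"
  unfolding pos_element_def
proof (intro conjI allI impI)
  have "cstar (x + 1 *\<^sub>R 1) = x + 1 *\<^sub>R 1" by (rule pos_element_selfadjoint[OF assms]) simp
  then show "cstar x = x" by (simp add: cstar_add)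
  fix t :: real assume "0 < t"
  then have "unit_element (x + (t / 2) *\<^sub>R 1 + (t / 2) *\<^sub>R 1)"
    by (intro pos_elementD assms) simp_all
  then show "unit_element (x + t *\<^sub>R 1)"
    by (simp add: add.assoc flip: scaleR_add_left)
qed

text \<open>Both sign conditions together leave only 0 in the spectrum, so the spectral norm bound
  applies with radius 0.\<close>

lemma pos_element_antisym:
  assumes x: "pos_element x" and y: "pos_element (- x)" shows "x = 0"
proof -
  have "norm x \<le> 0"
  proof (rule norm_selfadjoint_le_spectral_bound)
    show "cstar x = x" using x by (rule pos_element_selfadjoint)
    fix t :: real assume "0 < \<bar>t\<bar>"
    then consider "0 < t" | "0 < - t" by linarith
    then show "unit_element (x - t *\<^sub>R 1)"
    proof cases
      case 1
      then have "unit_element (- (- x + t *\<^sub>R 1))" by (intro unit_element_minus pos_elementD y)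
      then show ?thesis by simp
    next
      case 2
      then show ?thesis using pos_elementD[OF x 2] by simp
    qed
  qed simp
  then show ?thesis by simp
qed

lemma norm_le_if_pos_element:
  assumes "pos_element (t *\<^sub>R 1 - u)" "pos_element (t *\<^sub>R 1 + u)" "0 \<le> t" shows "norm u \<le> t"
proof (rule norm_selfadjoint_le_spectral_bound)
  show "cstar u = u"
    using pos_element_selfadjoint[OF assms(2)] by (simp add: cstar_add cstar_scaleR)
  fix s :: real assume "t < \<bar>s\<bar>"
  then consider "t < s" | "t < - s" by linarith
  then show "unit_element (u - s *\<^sub>R 1)"
  proof cases
    case 1
    then have "unit_element (- (t *\<^sub>R 1 - u + (s - t) *\<^sub>R 1))"
      by (intro unit_element_minus pos_elementD assms(1)) simp
    then show ?thesis by (simp add: algebra_simps)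
  next
    case 2
    then have "unit_element (t *\<^sub>R 1 + u + (- s - t) *\<^sub>R 1)"
      by (intro pos_elementD assms(2)) simp
    then show ?thesis by (simp add: algebra_simps)
  qed
qed (rule assms(3))

text \<open>Factor \<open>c * c + t\<close> as \<open>(c - z) * (c + z)\<close> with
  \<open>z = \<i> * sqrt t\<close>; both factors are invertible because \<open>c\<close> is
  self-adjoint.\<close>

lemma pos_element_square:
  assumes c: "cstar c = c" shows "pos_element (c * c)"
  unfolding pos_element_def
proof (intro conjI allI impI)
  show "cstar (c * c) = c * c" using c by (simp add: cstar_mult)
  fix t :: real assume t: "0 < t"
  define z where "z = \<i> * complex_of_real (sqrt t)"
  have "unit_element ((c - scaleC z 1) * (c - scaleC (- z) 1))"
    using t by (intro unit_element_mult unit_element_selfadjoint_minus_nonreal c) (simp_all add: z_def)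
  also have "(c - scaleC z 1) * (c - scaleC (- z) 1) = c * c - scaleC (z * z) 1"
    by (simp add: algebra_simps mult_scaleC_left mult_scaleC_right scaleC_scaleC scaleC_minus_left
        scaleC_diff_right scaleC_add_right)
  also have "z * z = - complex_of_real t"
    using t by (simp add: z_def algebra_simps flip: of_real_mult)
  finally show "unit_element (c * c + t *\<^sub>R 1)" by (simp add: scaleC_minus_left scaleR_scaleC)
qed

lemma inverses_selfadjoint:
  fixes x y :: "'a::unital_cstar_algebra"
  assumes "inverses x y" "cstar x = x" shows "cstar y = y"
proof -
  have "cstar y * x = 1" using assms by (metis cstar_mult cstar_one inverses_def)
  then show ?thesis using assms(1) by (metis inverses_def mult.assoc mult.left_neutral mult.right_neutral)
qed

text \<open>Factor \<open>y - e + s\<close> as \<open>y * (1 + (s - e) * (x + t))\<close>. The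
  second factor is invertible by positivity of \<open>x\<close> when \<open>s > e\<close>, and by
  the Neumann series otherwise.\<close>

lemma pos_element_inverses_minus:
  assumes x: "pos_element x" and t: "0 < t" and xy: "inverses (x + t *\<^sub>R 1) y"
    and e: "0 < e" "e * norm (x + t *\<^sub>R 1) < 1"
  shows "pos_element (y - e *\<^sub>R 1)"
  unfolding pos_element_def
proof (intro conjI allI impI)
  have "cstar (x + t *\<^sub>R 1) = x + t *\<^sub>R 1"
    using x by (simp add: pos_element_def cstar_add cstar_scaleR)
  then have "cstar y = y" using xy by (rule inverses_selfadjoint[rotated])
  then show "cstar (y - e *\<^sub>R 1) = y - e *\<^sub>R 1" by (simp add: cstar_diff cstar_scaleR)
  have y: "unit_element y" using xy inverses_sym unit_elementI by blast
  fix s :: real assume s: "0 < s"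
  have eq: "y - e *\<^sub>R 1 + s *\<^sub>R 1 = y * (1 + (s - e) *\<^sub>R (x + t *\<^sub>R 1))"
  proof -
    have "y * (1 + (s - e) *\<^sub>R (x + t *\<^sub>R 1)) = y + (s - e) *\<^sub>R (y * (x + t *\<^sub>R 1))"
      by (simp only: distrib_left mult_1_right mult_scaleR_right)
    also have "\<dots> = y + (s - e) *\<^sub>R 1" using xy by (simp add: inverses_def)
    finally show ?thesis by (simp add: scaleR_left_diff_distrib)
  qed
  have "unit_element (1 + (s - e) *\<^sub>R (x + t *\<^sub>R 1))"
  proof (cases "s > e")
    case True
    then have "unit_element ((s - e) *\<^sub>R (x + (t + 1 / (s - e)) *\<^sub>R 1))"
      using t by (intro unit_element_scaleR pos_elementD x) (simp_all add: add_pos_pos)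
    then show ?thesis using True by (simp add: algebra_simps)
  next
    case False
    have "norm ((e - s) *\<^sub>R (x + t *\<^sub>R 1)) \<le> e * norm (x + t *\<^sub>R 1)"
      using False s by (simp add: mult_right_mono)
    then have "unit_element (1 - (e - s) *\<^sub>R (x + t *\<^sub>R 1))"
      using e by (intro unit_element_one_minus) simp
    then show ?thesis by (simp add: algebra_simps)
  qed
  then show "unit_element (y - e *\<^sub>R 1 + s *\<^sub>R 1)"
    unfolding eq by (intro unit_element_mult y)
qed

text \<open>For strictly positive \<open>k\<close>, invertibility of \<open>\<mu> + c k c\<close> reduces to that of
  \<open>\<mu> + k c c = k (\<mu> k\<^sup>-\<^sup>1 + c c)\<close>, where the bracket is a sum of positive elements.\<close>
lemma pos_element_congruence:
  assumes k: "pos_element k" and c: "cstar c = c" shows "pos_element (c * k * c)"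
proof (rule pos_element_limit)
  define m where "m = norm (c * c)"
  have strict: "pos_element (c * (k + t *\<^sub>R 1) * c)" if t: "0 < t" for t
    unfolding pos_element_def
  proof (intro conjI allI impI)
    show "cstar (c * (k + t *\<^sub>R 1) * c) = c * (k + t *\<^sub>R 1) * c"
      using c k by (simp add: cstar_mult cstar_add cstar_scaleR pos_element_def mult.assoc)
    fix \<mu> :: real assume \<mu>: "0 < \<mu>"
    obtain y where y: "inverses (k + t *\<^sub>R 1) y"
      using pos_elementD[OF k t] by (auto simp: unit_element_def)
    \<comment> \<open>A lower bound for the inverse \<open>y\<close> of \<open>k + t\<close>. It
      leaves the spare term \<open>\<mu> * e\<close> that turns positivity of the bracket into
      invertibility.\<close>
    define e where "e = 1 / (1 + norm (k + t *\<^sub>R 1))"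
    have e: "0 < e" "e * norm (k + t *\<^sub>R 1) < 1"
      by (simp_all add: e_def add_pos_nonneg field_simps)
    have "pos_element (\<mu> *\<^sub>R (y - e *\<^sub>R 1) + c * c)"
      using \<mu> by (intro pos_element_add pos_element_scaleR pos_element_square c
          pos_element_inverses_minus[OF k t y e]) simp
    then have "unit_element (\<mu> *\<^sub>R (y - e *\<^sub>R 1) + c * c + (\<mu> * e) *\<^sub>R 1)"
      using \<mu> e by (intro pos_elementD) simp_all
    then have "unit_element (\<mu> *\<^sub>R y + c * c)" by (simp add: algebra_simps)
    then have "unit_element ((k + t *\<^sub>R 1) * (\<mu> *\<^sub>R y + c * c))"
      by (intro unit_element_mult pos_elementD k t)
    also have "(k + t *\<^sub>R 1) * (\<mu> *\<^sub>R y + c * c) = \<mu> *\<^sub>R 1 + (k + t *\<^sub>R 1) * (c * c)"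
      using y by (simp add: distrib_left[of "k + t *\<^sub>R 1"] inverses_def)
    finally have "unit_element ((1 / \<mu>) *\<^sub>R (\<mu> *\<^sub>R 1 + (k + t *\<^sub>R 1) * (c * c)))"
      using \<mu> by (intro unit_element_scaleR) simp_all
    also have "(1 / \<mu>) *\<^sub>R (\<mu> *\<^sub>R 1 + (k + t *\<^sub>R 1) * (c * c)) = 1 + ((1 / \<mu>) *\<^sub>R ((k + t *\<^sub>R 1) * c)) * c"
      using \<mu> by (simp add: scaleR_add_right mult.assoc)
    finally have "unit_element (1 + c * ((1 / \<mu>) *\<^sub>R ((k + t *\<^sub>R 1) * c)))"
      by (rule unit_element_one_plus_swap)
    then have "unit_element (\<mu> *\<^sub>R (1 + c * ((1 / \<mu>) *\<^sub>R ((k + t *\<^sub>R 1) * c))))"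
      using \<mu> by (intro unit_element_scaleR) simp_all
    then show "unit_element (c * (k + t *\<^sub>R 1) * c + \<mu> *\<^sub>R 1)"
      using \<mu> by (simp add: scaleR_add_right mult.assoc add.commute)
  qed
  fix e :: real assume e: "0 < e"
  \<comment> \<open>Replacing \<open>k\<close> by \<open>k + t\<close> adds
    \<open>t * (c * c)\<close>, of norm at most \<open>e\<close>, which the surplus \<open>e\<close>
    absorbs.\<close>
  define t where "t = e / (1 + m)"
  have m: "0 \<le> m" by (simp add: m_def)
  have t: "0 < t" "t * m \<le> e" using e m by (simp_all add: t_def field_simps add_pos_nonneg)
  have "pos_element (c * (k + t *\<^sub>R 1) * c + (e *\<^sub>R 1 - t *\<^sub>R (c * c)))"
    using t m_def c
    by (intro pos_element_add strict pos_element_norm_minus) (simp_all add: cstar_mult cstar_scaleR)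
  then show "pos_element (c * k * c + e *\<^sub>R 1)"
    by (simp add: algebra_simps)
qed

section \<open>Square roots\<close>

text \<open>If \<open>1 - w\<close> is a square root of \<open>1 - h\<close>, then \<open>w\<close> is a fixed point of
  \<open>w \<mapsto> (h + w\<^sup>2) / 2\<close>. The increments of the iteration are dominated by those of the scalar
  iteration for \<open>h = 1\<close>, which is increasing and bounded by 1.\<close>

primrec sqrt_iter :: "'a::real_algebra_1 \<Rightarrow> nat \<Rightarrow> 'a" where
  "sqrt_iter h 0 = 0"
| "sqrt_iter h (Suc n) = (1 / 2) *\<^sub>R (h + sqrt_iter h n * sqrt_iter h n)"

lemma sqrt_iter_commute:
  assumes "z * h = h * z" shows "z * sqrt_iter h n = sqrt_iter h n * z"
proof (induction n)
  case (Suc n)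
  have "z * (sqrt_iter h n * sqrt_iter h n) = sqrt_iter h n * sqrt_iter h n * z"
    by (metis Suc mult.assoc)
  then show ?case using assms by (simp add: algebra_simps)
qed simp

lemma cstar_sqrt_iter:
  "cstar h = h \<Longrightarrow> cstar (sqrt_iter h n) = sqrt_iter h (n::nat)" for h :: "'a::unital_cstar_algebra"
  by (induction n) (simp_all add: cstar_add cstar_mult cstar_scaleR)

lemma norm_sqrt_iter_le:
  fixes h :: "'a::unital_cstar_algebra"
  assumes "norm h \<le> 1" shows "norm (sqrt_iter h n) \<le> sqrt_iter 1 n"
proof (induction n)
  case (Suc n)
  have "norm (sqrt_iter h n * sqrt_iter h n) \<le> sqrt_iter 1 n * sqrt_iter 1 n"
    by (rule order_trans[OF norm_mult_ineq]) (intro mult_mono Suc norm_ge_zero order_trans[OF norm_ge_zero Suc])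
  then show ?case
    using norm_triangle_ineq[of h "sqrt_iter h n * sqrt_iter h n"] assms by simp
qed simp

text \<open>The iterates commute, so a new increment is half the old increment times the sum of the
  two iterates. Taking norms gives the bound, and the scalar iteration satisfies the same recursion
  exactly.\<close>

lemma norm_sqrt_iter_diff_le:
  fixes h :: "'a::unital_cstar_algebra"
  assumes "norm h \<le> 1"
  shows "norm (sqrt_iter h (Suc n) - sqrt_iter h n) \<le> sqrt_iter 1 (Suc n) - sqrt_iter 1 n"
proof (induction n)
  case 0
  then show ?case using assms by simp
next
  case (Suc n)
  let ?w = "sqrt_iter h" and ?r = "sqrt_iter (1::real)"
  have comm: "?w (Suc n) * ?w n = ?w n * ?w (Suc n)"
    using sqrt_iter_commute[OF sqrt_iter_commute[OF refl, symmetric], of h "Suc n" n] by simp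
  have "?w (Suc (Suc n)) - ?w (Suc n) = (1 / 2) *\<^sub>R (?w (Suc n) * ?w (Suc n) - ?w n * ?w n)"
    by (subst (1 2) sqrt_iter.simps(2)) (simp only: scaleR_right_diff_distrib[symmetric] add_diff_cancel_left)
  also have "?w (Suc n) * ?w (Suc n) - ?w n * ?w n = (?w (Suc n) - ?w n) * (?w (Suc n) + ?w n)"
    by (simp only: left_diff_distrib distrib_left comm) simp
  finally have "norm (?w (Suc (Suc n)) - ?w (Suc n)) \<le>
      norm (?w (Suc n) - ?w n) * norm (?w (Suc n) + ?w n) / 2"
    using norm_mult_ineq[of "?w (Suc n) - ?w n" "?w (Suc n) + ?w n"] by simp
  also have "\<dots> \<le> (?r (Suc n) - ?r n) * (?r (Suc n) + ?r n) / 2"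
    using order_trans[OF norm_triangle_ineq add_mono[OF norm_sqrt_iter_le norm_sqrt_iter_le], OF assms assms]
    by (intro divide_right_mono mult_mono Suc norm_ge_zero order_trans[OF norm_ge_zero Suc] zero_le_numeral)
  also have "\<dots> = ?r (Suc (Suc n)) - ?r (Suc n)"
  proof -
    have "?r (Suc m) = (1 + ?r m * ?r m) / 2" for m by simp
    from this[of "Suc n"] this[of n]
    show ?thesis using square_diff_square_factored[of "?r (Suc n)" "?r n"] by argo
  qed
  finally show ?case .
qed

lemma sqrt_iter_one_le: "0 \<le> sqrt_iter (1::real) n \<and> sqrt_iter (1::real) n \<le> 1"
proof (induction n)
  case (Suc n)
  then have "sqrt_iter (1::real) n * sqrt_iter 1 n \<le> 1" "0 \<le> sqrt_iter (1::real) n * sqrt_iter 1 n"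
    by (auto intro: mult_le_one)
  then show ?case by simp
qed simp

text \<open>Positivity puts \<open>h = 1 - x / norm x\<close> in the unit ball; from the limit
  \<open>w\<close> of the iteration the root is \<open>sqrt t * (1 - w)\<close>, positive because
  \<open>norm w \<le> 1\<close>. The commutation clause serves the uniqueness proof.\<close>

lemma pos_element_sqrt_exists:
  assumes x: "pos_element x"
  shows "\<exists>s. pos_element s \<and> s * s = x \<and> (\<forall>z. z * x = x * z \<longrightarrow> z * s = s * z)"
proof (cases "x = 0")
  case True
  then show ?thesis by (intro exI[of _ 0]) (simp add: pos_element_zero)
next
  case False
  define t where "t = norm x"
  have t: "0 < t" using False by (simp add: t_def)
  define h where "h = 1 - (1 / t) *\<^sub>R x"
  have h: "cstar h = h"
    using x by (simp add: h_def cstar_diff cstar_scaleR pos_element_def)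
  have "h = (1 / t) *\<^sub>R (t *\<^sub>R 1 - x)" using t by (simp add: h_def scaleR_right_diff_distrib)
  then have "norm h = norm (t *\<^sub>R 1 - x) / t" using t by simp
  then have nh: "norm h \<le> 1"
    using pos_element_norm_le[OF x, of t] t by (simp add: t_def)
  let ?r = "sqrt_iter (1::real)"
  \<comment> \<open>The scalar increment dominates a norm, hence is nonnegative.\<close>
  have mono: "?r n \<le> ?r (Suc n)" for n
    using order_trans[OF norm_ge_zero norm_sqrt_iter_diff_le[OF nh, of n]] by linarith
  have "convergent ?r"
  proof (rule Bseq_monoseq_convergent)
    have "norm (?r n) \<le> 1" for n using sqrt_iter_one_le[of n] by simp
    then show "Bseq ?r" by (rule BseqI')
    show "monoseq ?r" unfolding monoseq_Suc using mono by blast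
  qed
  then have "summable (\<lambda>n. ?r (Suc n) - ?r n)"
    using telescope_summable convergent_def by blast
  then have "summable (\<lambda>n. sqrt_iter h (Suc n) - sqrt_iter h n)"
    by (rule summable_comparison_test'[where N = 0]) (rule norm_sqrt_iter_diff_le[OF nh])
  then have "convergent (\<lambda>n. \<Sum>i<n. sqrt_iter h (Suc i) - sqrt_iter h i)"
    by (simp add: summable_iff_convergent)
  then have "convergent (sqrt_iter h)"
    by (simp add: sum_lessThan_telescope del: sqrt_iter.simps(2))
  then obtain w where w: "sqrt_iter h \<longlonglongrightarrow> w" by (auto simp: convergent_def)
  have "(\<lambda>n. sqrt_iter h (Suc n)) \<longlonglongrightarrow> (1 / 2) *\<^sub>R (h + w * w)"
    by (simp, intro tendsto_intros w)
  then have "w = (1 / 2) *\<^sub>R (h + w * w)"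
    using LIMSEQ_unique LIMSEQ_Suc[OF w] by blast
  from arg_cong[OF this, of "scaleR 2"] have fixpoint: "2 *\<^sub>R w = h + w * w" by simp
  have "norm (sqrt_iter h n) \<le> 1" for n
    using sqrt_iter_one_le[of n] norm_sqrt_iter_le[OF nh, of n] by linarith
  then have nw: "norm w \<le> 1"
    using LIMSEQ_le_const2[OF tendsto_norm[OF w]] by blast
  have comm: "z * w = w * z" if z: "z * x = x * z" for z
  proof -
    have "z * h = h * z" using z by (simp add: h_def algebra_simps)
    then have "(\<lambda>n. z * sqrt_iter h n) = (\<lambda>n. sqrt_iter h n * z)"
      by (simp add: sqrt_iter_commute)
    moreover have "(\<lambda>n. z * sqrt_iter h n) \<longlonglongrightarrow> z * w" "(\<lambda>n. sqrt_iter h n * z) \<longlonglongrightarrow> w * z"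
      by (intro tendsto_intros w)+
    ultimately show ?thesis using LIMSEQ_unique by metis
  qed
  have cw: "cstar w = w"
  proof -
    have "(\<lambda>n. norm (cstar (sqrt_iter h n - w))) \<longlonglongrightarrow> 0"
      using tendsto_norm_zero[OF LIM_zero[OF w]] by simp
    then have "(\<lambda>n. cstar (sqrt_iter h n - w)) \<longlonglongrightarrow> 0" by (rule tendsto_norm_zero_cancel)
    then have "sqrt_iter h \<longlonglongrightarrow> cstar w"
      by (simp add: cstar_diff cstar_sqrt_iter[OF h] LIM_zero_iff)
    then show ?thesis using w LIMSEQ_unique by blast
  qed
  define s where "s = sqrt t *\<^sub>R (1 - w)"
  have "pos_element s"
    unfolding s_def
    using t cw nw pos_element_norm_minus[of w 1] by (intro pos_element_scaleR) simp_all
  moreover have "s * s = x"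
  proof -
    have "s * s = t *\<^sub>R ((1 - w) * (1 - w))" using t by (simp add: s_def)
    also have "(1 - w) * (1 - w) = 1 + w * w - 2 *\<^sub>R w"
      by (simp add: algebra_simps scaleR_2)
    also have "\<dots> = (1 / t) *\<^sub>R x" unfolding fixpoint by (simp add: h_def)
    finally show ?thesis using t by simp
  qed
  moreover have "z * s = s * z" if "z * x = x * z" for z
    using comm[OF that] by (simp add: s_def algebra_simps)
  ultimately show ?thesis by blast
qed

text \<open>Both roots are compared with the constructed root \<open>s\<close>, which commutes with
  each. For \<open>d = b - s\<close> the positive elements \<open>d * b * d\<close> and
  \<open>d * s * d\<close> sum to 0, so both vanish, and their difference is the cube of
  \<open>d\<close>.\<close>

lemma pos_element_sqrt_unique:
  assumes b: "pos_element b" and c: "pos_element c" and eq: "b * b = c * c"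
  shows "b = c"
proof -
  have "b = s" if s: "pos_element s" "s * s = b * b" "b * s = s * b" and b: "pos_element b"
    for b s :: 'a
  proof -
    define d where "d = b - s"
    have d: "cstar d = d" using b s by (simp add: d_def cstar_diff pos_element_def)
    have z: "d * (b + s) = 0" using s by (simp add: d_def algebra_simps)
    have "d * b * d + d * s * d = d * (b + s) * d" by (simp add: algebra_simps)
    then have "d * s * d = - (d * b * d)" unfolding z by (simp add: eq_neg_iff_add_eq_0 add.commute)
    moreover have P: "pos_element (d * b * d)" "pos_element (d * s * d)"
      by (intro pos_element_congruence d b s)+
    ultimately have "d * b * d = 0" "d * s * d = 0"
      using pos_element_antisym[of "d * b * d"] by simp_all
    moreover have "d * (b - s) * d = d * b * d - d * s * d"
      by (simp only: left_diff_distrib right_diff_distrib)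
    ultimately have "d * d * d = 0" by (simp flip: d_def)
    then have "norm ((d * d) * (d * d)) = 0" by (simp add: mult.assoc)
    then have "norm d = 0"
      using norm_selfadjoint_square[OF d] norm_selfadjoint_square[of "d * d"] d
      by (simp add: cstar_mult)
    then show ?thesis by (simp add: d_def)
  qed note uniq = this
  obtain s where s: "pos_element s" "s * s = c * c" "\<And>z. z * (c * c) = c * c * z \<Longrightarrow> z * s = s * z"
    using pos_element_sqrt_exists[OF pos_element_square[OF pos_element_selfadjoint[OF c]]] by blast
  have "c * s = s * c" by (rule s) (simp add: mult.assoc)
  moreover have "b * s = s * b" by (rule s) (simp add: mult.assoc flip: eq)
  ultimately show ?thesis using uniq[of s b] uniq[of s c] s b c eq by metis
qed

section \<open>A Hahn--Banach theorem for cones\<close>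

text \<open>The cone \<open>C\<close> plays the role of the epigraph of a sublinear functional. A maximal cone above
  \<open>C\<close> that still has no point \<open>(0, \<alpha>)\<close> with \<open>\<alpha> < 0\<close> contains, for each \<open>w\<close>, a line through
  some \<open>(w, \<beta>)\<close>, and \<open>w \<mapsto> \<beta>\<close> is the functional.\<close>

lemma hahn_banach_cone:
  fixes C :: "('a::real_vector \<times> real) set"
  assumes cone: "convex_cone C" and total: "\<And>w. \<exists>\<alpha>. (w, \<alpha>) \<in> C"
    and nonneg: "\<And>\<alpha>. (0, \<alpha>) \<in> C \<Longrightarrow> 0 \<le> \<alpha>"
  shows "\<exists>h. linear h \<and> (\<forall>w \<alpha>. (w, \<alpha>) \<in> C \<longrightarrow> h w \<le> \<alpha>)"
proof -
  define A where "A = {D. convex_cone D \<and> C \<subseteq> D \<and> (\<forall>\<alpha>. (0, \<alpha>) \<in> D \<longrightarrow> 0 \<le> \<alpha>)}"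
  have "\<exists>M\<in>A. \<forall>X\<in>A. M \<subseteq> X \<longrightarrow> X = M"
  proof (rule subset_Zorn_nonempty)
    show "A \<noteq> {}" using cone nonneg by (auto simp: A_def)
    fix \<C> assume ne: "\<C> \<noteq> {}" and chain: "subset.chain A \<C>"
    then have sub: "\<C> \<subseteq> A" and lin: "\<And>X Y. X \<in> \<C> \<Longrightarrow> Y \<in> \<C> \<Longrightarrow> X \<subseteq> Y \<or> Y \<subseteq> X"
      by (auto simp: subset_chain_def)
    have "x + y \<in> \<Union>\<C>" if xy: "x \<in> \<Union>\<C>" "y \<in> \<Union>\<C>" for x y
    proof -
      obtain X Y where "X \<in> \<C>" "x \<in> X" "Y \<in> \<C>" "y \<in> Y" using xy by blast
      then obtain Z where Z: "Z \<in> \<C>" "x \<in> Z" "y \<in> Z" using lin by blast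
      then have "x + y \<in> Z" using sub by (auto simp: A_def intro: convex_cone_add)
      then show ?thesis using Z by blast
    qed
    moreover have "c *\<^sub>R x \<in> \<Union>\<C>" if "x \<in> \<Union>\<C>" "0 \<le> c" for x c
      using that sub by (auto simp: A_def intro: convex_cone_scaleR)
    moreover have "0 \<in> \<Union>\<C>"
      using ne sub convex_cone_contains_0 unfolding A_def by blast
    ultimately have "convex_cone (\<Union>\<C>)" by (simp add: convex_cone_iff)
    then show "\<Union>\<C> \<in> A" using sub ne by (auto simp: A_def)
  qed
  then obtain M where "M \<in> A" and max: "\<And>X. X \<in> A \<Longrightarrow> M \<subseteq> X \<Longrightarrow> X = M" by blast
  then have M: "convex_cone M" "C \<subseteq> M" and nonnegM: "\<And>\<alpha>. (0, \<alpha>) \<in> M \<Longrightarrow> 0 \<le> \<alpha>"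
    by (auto simp: A_def)
  have add: "(w + w', \<alpha> + \<alpha>') \<in> M" if "(w, \<alpha>) \<in> M" "(w', \<alpha>') \<in> M" for w w' \<alpha> \<alpha>'
    using convex_cone_add[OF M(1) that] by simp
  have scale: "(c *\<^sub>R w, c * \<alpha>) \<in> M" if "(w, \<alpha>) \<in> M" "0 \<le> c" for w \<alpha> c
    using convex_cone_scaleR[OF M(1) that(2,1)] by simp
  have le: "- \<beta> \<le> \<alpha>" if "(w, \<alpha>) \<in> M" "(- w, \<beta>) \<in> M" for w \<alpha> \<beta>
    using nonnegM[of "\<alpha> + \<beta>"] add[OF that] by simp
  \<comment> \<open>Adjoining the ray through this point still yields no
    \<open>(0, \<gamma>)\<close> with \<open>\<gamma> < 0\<close>, by definition of the infimum;
    maximality then puts the point into \<open>M\<close>.\<close>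
  have inf: "(- w, - Inf {\<alpha>. (w, \<alpha>) \<in> M}) \<in> M" for w
  proof -
    let ?S = "{\<alpha>. (w, \<alpha>) \<in> M}"
    obtain \<alpha>' where "(- w, \<alpha>') \<in> M" using total M(2) by blast
    then have bdd: "bdd_below ?S" using le by (intro bdd_belowI[of _ "- \<alpha>'"]) blast
    define p where "p = (- w, - Inf ?S)"
    define D where "D = {u + t *\<^sub>R p | u t. u \<in> M \<and> 0 \<le> t}"
    have sub: "M \<subseteq> D" unfolding D_def by (force intro: exI[of _ "0::real"])
    have "x + y \<in> D" if "x \<in> D" "y \<in> D" for x y
    proof -
      obtain u t v r where uv: "u \<in> M" "0 \<le> t" "v \<in> M" "0 \<le> r" "x = u + t *\<^sub>R p" "y = v + r *\<^sub>R p"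
        using \<open>x \<in> D\<close> \<open>y \<in> D\<close> unfolding D_def by blast
      then have "x + y = (u + v) + (t + r) *\<^sub>R p" by (simp add: algebra_simps)
      then show ?thesis using uv convex_cone_add[OF M(1)] unfolding D_def by fastforce
    qed
    moreover have "c *\<^sub>R x \<in> D" if "x \<in> D" "0 \<le> c" for x c
    proof -
      obtain u t where u: "u \<in> M" "0 \<le> t" "x = u + t *\<^sub>R p"
        using \<open>x \<in> D\<close> unfolding D_def by blast
      then have "c *\<^sub>R x = c *\<^sub>R u + (c * t) *\<^sub>R p" by (simp add: algebra_simps)
      then show ?thesis using u \<open>0 \<le> c\<close> convex_cone_scaleR[OF M(1)] unfolding D_def by fastforce
    qed
    moreover have "0 \<in> D" using sub convex_cone_contains_0[OF M(1)] by blast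
    ultimately have "convex_cone D" by (simp add: convex_cone_iff)
    moreover have "0 \<le> \<gamma>" if \<gamma>: "(0, \<gamma>) \<in> D" for \<gamma>
    proof -
      obtain u t where u: "u \<in> M" "0 \<le> t" "(0, \<gamma>) = u + t *\<^sub>R p" using \<gamma> unfolding D_def by blast
      then have "u = (t *\<^sub>R w, \<gamma> + t * Inf ?S)"
        by (cases u) (auto simp: p_def algebra_simps)
      with u(1) have uM: "(t *\<^sub>R w, \<gamma> + t * Inf ?S) \<in> M" by simp
      show ?thesis
      proof (cases "t = 0")
        case True
        then show ?thesis using uM nonnegM by simp
      next
        case False
        then have "(w, (1 / t) * (\<gamma> + t * Inf ?S)) \<in> M"
          using scale[of "t *\<^sub>R w" "\<gamma> + t * Inf ?S" "1 / t"] uM u(2) by simp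
        then have "Inf ?S \<le> (1 / t) * (\<gamma> + t * Inf ?S)"
          using bdd by (intro cInf_lower) simp_all
        then have "0 \<le> \<gamma> / t" using False by (simp add: add_divide_distrib)
        then show ?thesis using False u(2) by (simp add: zero_le_divide_iff)
      qed
    qed
    ultimately have "D = M" using sub M by (intro max) (auto simp: A_def)
    moreover have "p \<in> D"
      using convex_cone_contains_0[OF M(1)] unfolding D_def
      by (intro CollectI exI[of _ "0 :: 'a \<times> real"] exI[of _ "1::real"]) simp
    ultimately show ?thesis by (simp add: p_def)
  qed
  have "\<exists>\<beta>. (w, \<beta>) \<in> M \<and> (- w, - \<beta>) \<in> M" for w
  proof -
    define \<beta> where "\<beta> = Inf {\<alpha>. (w, \<alpha>) \<in> M}"
    have \<beta>: "(- w, - \<beta>) \<in> M" unfolding \<beta>_def by (rule inf)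
    \<comment> \<open>Knowing the infimum over \<open>- w\<close>, a second use of
      \<open>inf\<close>, at \<open>- w\<close>, gives the opposite point
      \<open>(w, \<beta>)\<close>.\<close>
    have "Inf {\<alpha>. (- w, \<alpha>) \<in> M} = - \<beta>"
    proof (rule cInf_eq_minimum)
      show "- \<beta> \<in> {\<alpha>. (- w, \<alpha>) \<in> M}" using \<beta> by simp
      fix \<alpha>' assume \<alpha>': "\<alpha>' \<in> {\<alpha>. (- w, \<alpha>) \<in> M}"
      have "- \<alpha>' \<le> \<beta>"
        unfolding \<beta>_def using total M(2) \<alpha>' le by (intro cInf_greatest) blast+
      then show "- \<beta> \<le> \<alpha>'" by simp
    qed
    then show ?thesis using inf[of "- w"] \<beta> by auto
  qed
  then obtain h where h: "\<And>w. (w, h w) \<in> M" "\<And>w. (- w, - h w) \<in> M" by metis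
  have hle: "h w \<le> \<alpha>" if "(w, \<alpha>) \<in> M" for w \<alpha>
    using le[OF that h(2)] by simp
  \<comment> \<open>The height of a line contained in \<open>M\<close> is unique, so linearity of
    \<open>h\<close> only requires the expected points to lie in \<open>M\<close>.\<close>
  have eq: "h w = \<beta>" if "(w, \<beta>) \<in> M" "(- w, - \<beta>) \<in> M" for w \<beta>
    using hle[OF that(1)] le[OF h(1) that(2)] by simp
  have "linear h"
  proof (rule linearI)
    show "h (v + w) = h v + h w" for v w
      using add[OF h(1)[of v] h(1)[of w]] add[OF h(2)[of v] h(2)[of w]] by (intro eq) simp_all
    have sc: "(c *\<^sub>R w, c * h w) \<in> M" for c w
    proof (cases "0 \<le> c")
      case True
      then show ?thesis using scale[OF h(1)] by blast
    next
      case False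
      then show ?thesis using scale[OF h(2), of "- c" w] by simp
    qed
    show "h (c *\<^sub>R w) = c *\<^sub>R h w" for c w
      using sc[of c w] sc[of "- c" w] by (intro eq) simp_all
  qed
  then show ?thesis using hle M(2) by blast
qed

section \<open>Positive elements of a general C*-algebra\<close>

definition emb :: "'a::cstar_algebra \<Rightarrow> 'a unitization" where
  "emb x = Unitization x 0"

lemma emb_add: "emb (x + y) = emb x + emb y"
  and emb_diff: "emb (x - y) = emb x - emb y"
  and emb_mult: "emb (x * y) = emb x * emb y"
  and emb_scaleC: "emb (scaleC c x) = scaleC c (emb x)"
  and emb_scaleR: "emb (r *\<^sub>R x) = r *\<^sub>R emb x"
  and emb_zero: "emb 0 = 0"
  and emb_cstar: "emb (cstar x) = cstar (emb x)"
  by (simp_all add: emb_def unitization_cstar_ops)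

lemma emb_eq_iff: "emb x = emb y \<longleftrightarrow> x = y"
  by (simp add: emb_def)

lemma emb_alg: "scal X = 0 \<Longrightarrow> emb (alg X) = X"
  by (cases X) (simp add: emb_def)

lemma scal_mult: "scal (X * Y) = scal X * scal Y"
  by (simp add: unitization_ops)

lemma scal_emb [simp]: "scal (emb x) = 0"
  by (simp add: emb_def)

text \<open>Testing left multiplication on \<open>cstar x\<close> shows that no norm is
  lost.\<close>

lemma norm_emb: "norm (emb x) = norm x"
proof (rule antisym)
  show "norm (emb x) \<le> norm x" using norm_unitization_le[of "emb x"] by (simp add: emb_def)
  have "norm x * norm x \<le> norm (emb x) * norm x"
  proof -
    have "norm x * norm x = norm (left_mult (emb x) (cstar x))"
      by (simp add: left_mult_def emb_def norm_mult_cstar)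
    also have "\<dots> \<le> onorm (left_mult (emb x)) * norm x"
      using norm_left_mult_le[of "emb x" "cstar x"] by simp
    also have "\<dots> \<le> norm (emb x) * norm x"
      by (intro mult_right_mono) (simp_all add: norm_unitization_def)
    finally show ?thesis .
  qed
  then show "norm x \<le> norm (emb x)" by (cases "x = 0") simp_all
qed

text \<open>An inverse of \<open>1 - emb x\<close> has scalar part 1, hence is
  \<open>1 - emb y\<close> for a quasi-inverse \<open>y\<close>.\<close>

lemma quasi_invertible_iff_unit_element:
  fixes x :: "'a::cstar_algebra"
  shows "quasi_invertible x \<longleftrightarrow> unit_element (1 - emb x)"
proof
  assume "quasi_invertible x"
  then obtain y where y: "x + y - x * y = 0" "x + y - y * x = 0"
    unfolding quasi_invertible_def by blast
  have "(1 - emb x) * (1 - emb y) = 1 - emb (x + y - x * y)"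
    "(1 - emb y) * (1 - emb x) = 1 - emb (x + y - y * x)"
    by (simp_all add: emb_add emb_diff emb_mult algebra_simps)
  then have "inverses (1 - emb x) (1 - emb y)" unfolding y by (simp add: inverses_def emb_zero)
  then show "unit_element (1 - emb x)" by (rule unit_elementI)
next
  assume "unit_element (1 - emb x)"
  then obtain Z where Z: "inverses (1 - emb x) Z" by (auto simp: unit_element_def)
  then have "scal ((1 - emb x) * Z) = scal (1 :: 'a unitization)" by (simp add: inverses_def)
  then have "scal (1 - Z) = 0" by (simp add: scal_mult scal_diff) (simp add: unitization_ops)
  then obtain y where "1 - Z = emb y" by (metis emb_alg)
  then have Zy: "Z = 1 - emb y" by (metis diff_diff_eq2 add_diff_cancel_left')
  have "emb (x + y - x * y) = 1 - (1 - emb x) * Z" "emb (x + y - y * x) = 1 - Z * (1 - emb x)"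
    by (simp_all add: Zy emb_add emb_diff emb_mult algebra_simps)
  then have "emb (x + y - x * y) = emb 0" "emb (x + y - y * x) = emb 0"
    using Z by (simp_all add: inverses_def emb_zero)
  then show "quasi_invertible x" unfolding quasi_invertible_def emb_eq_iff by blast
qed

lemma quasi_invertible_scaleC_iff:
  assumes "z \<noteq> 0"
  shows "quasi_invertible (scaleC (inverse z) x) \<longleftrightarrow> unit_element (emb x - scaleC z 1)"
proof -
  have 1: "1 - emb (scaleC (inverse z) x) = scaleC (- inverse z) (emb x - scaleC z 1)"
    "emb x - scaleC z 1 = scaleC (- z) (1 - emb (scaleC (inverse z) x))"
    using assms by (simp_all add: emb_scaleC scaleC_diff_right scaleC_scaleC scaleC_minus_left scaleC_one)
  show ?thesis
    unfolding quasi_invertible_iff_unit_element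
    using unit_element_scaleC[of "emb x - scaleC z 1" "- inverse z"]
      unit_element_scaleC[of "1 - emb (scaleC (inverse z) x)" "- z"] assms
    unfolding 1(1)[symmetric] 1(2)[symmetric] by auto
qed

text \<open>The bridge that carries the results on unital algebras to the given notion of
  positivity.\<close>

lemma cstar_positive_iff_pos_element: "cstar_positive x \<longleftrightarrow> pos_element (emb x)"
proof
  assume x: "cstar_positive x"
  show "pos_element (emb x)"
    unfolding pos_element_def
  proof (intro conjI allI impI)
    show "cstar (emb x) = emb x" using x by (simp add: cstar_positive_def flip: emb_cstar)
    fix t :: real assume t: "0 < t"
    then have "complex_of_real (- t) \<notin> complex_of_real ` {0..}" by (auto simp del: of_real_minus)
    then have "complex_of_real (- t) \<notin> cstar_spectrum x" using x by (auto simp: cstar_positive_def)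
    then have "unit_element (emb x - scaleC (complex_of_real (- t)) 1)"
      using t by (simp add: cstar_spectrum_def flip: quasi_invertible_scaleC_iff)
    then show "unit_element (emb x + t *\<^sub>R 1)" by (simp add: scaleC_minus_left scaleR_scaleC)
  qed
next
  assume x: "pos_element (emb x)"
  have sa: "cstar (emb x) = emb x" using x by (rule pos_element_selfadjoint)
  then have "cstar x = x" by (simp add: emb_eq_iff flip: emb_cstar)
  moreover have "z \<in> complex_of_real ` {0..}" if z: "z \<in> cstar_spectrum x" for z
  proof (rule ccontr)
    assume nz: "z \<notin> complex_of_real ` {0..}"
    then have z0: "z \<noteq> 0" by force
    have "unit_element (emb x - scaleC z 1)"
    proof (cases "Im z = 0")
      case True
      then have e: "z = complex_of_real (Re z)" by (simp add: complex_eq_iff)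
      with nz have "Re z < 0" by (metis atLeast_iff image_eqI not_less)
      then have "unit_element (emb x + (- Re z) *\<^sub>R 1)" by (intro pos_elementD x) simp
      then have "unit_element (emb x - scaleC (complex_of_real (Re z)) 1)"
        by (simp add: scaleR_scaleC scaleC_minus_left)
      then show ?thesis using e by simp
    next
      case False
      then show ?thesis by (rule unit_element_selfadjoint_minus_nonreal[OF sa])
    qed
    then show False using z z0 by (simp add: cstar_spectrum_def quasi_invertible_scaleC_iff)
  qed
  ultimately show "cstar_positive x" by (auto simp: cstar_positive_def)
qed

lemma cstar_positive_selfadjoint: "cstar_positive x \<Longrightarrow> cstar x = x"
  by (simp add: cstar_positive_def)

lemma cstar_positive_add: "cstar_positive x \<Longrightarrow> cstar_positive y \<Longrightarrow> cstar_positive (x + y)"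
  by (simp add: cstar_positive_iff_pos_element emb_add pos_element_add)

lemma cstar_positive_scaleR: "cstar_positive x \<Longrightarrow> 0 \<le> c \<Longrightarrow> cstar_positive (c *\<^sub>R x)"
  by (simp add: cstar_positive_iff_pos_element emb_scaleR pos_element_scaleR)

lemma cstar_positive_zero: "cstar_positive 0"
  by (simp add: cstar_positive_iff_pos_element emb_zero pos_element_zero)

text \<open>The root found in the unitization has a scalar part with square 0, so it lies in the
  algebra; uniqueness then justifies the description operator.\<close>

lemma cstar_sqrt_positive:
  assumes a: "cstar_positive a"
  shows "cstar_positive (cstar_sqrt a)" and "cstar_sqrt a * cstar_sqrt a = a"
proof -
  obtain S where S: "pos_element S" "S * S = emb a"
    using pos_element_sqrt_exists a unfolding cstar_positive_iff_pos_element by blast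
  then have "scal S * scal S = 0" by (metis scal_mult scal_emb)
  then obtain s where s: "S = emb s" by (metis emb_alg mult_eq_0_iff)
  have "\<exists>!b. cstar_positive b \<and> b * b = a"
  proof (rule ex1I[of _ s])
    show "cstar_positive s \<and> s * s = a"
      using S by (simp add: s cstar_positive_iff_pos_element emb_eq_iff flip: emb_mult)
    fix b assume "cstar_positive b \<and> b * b = a"
    then show "b = s"
      using pos_element_sqrt_unique[of "emb b" "emb s"] S
      by (simp add: s cstar_positive_iff_pos_element emb_eq_iff flip: emb_mult)
  qed
  then have "cstar_positive (cstar_sqrt a) \<and> cstar_sqrt a * cstar_sqrt a = a"
    unfolding cstar_sqrt_def by (rule theI')
  then show "cstar_positive (cstar_sqrt a)" "cstar_sqrt a * cstar_sqrt a = a" by simp_all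
qed

section \<open>Functionals\<close>

lemma cbounded_functional_linear:
  assumes "cbounded_functional f"
  shows "f (x + y) = f x + f y" "f (scaleC c x) = c * f x" "f (r *\<^sub>R x) = of_real r * f x"
    "f 0 = 0" "f (- x) = - f x" "f (x - y) = f x - f y"
proof -
  show add: "f (x + y) = f x + f y" for x y using assms by (simp add: cbounded_functional_def)
  show sc: "f (scaleC c x) = c * f x" for c x using assms by (simp add: cbounded_functional_def)
  show "f (r *\<^sub>R x) = of_real r * f x" by (simp add: scaleR_scaleC sc)
  show "f 0 = 0" using sc[of 0 0] by simp
  show m: "f (- x) = - f x" for x using sc[of "-1" x] by (simp add: scaleC_minus_left scaleC_one)
  show "f (x - y) = f x - f y" using add[of x "- y"] by (simp add: m)
qed

lemma cbounded_functional_bound: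
  assumes "cbounded_functional f" obtains F where "0 \<le> F" "\<And>x. cmod (f x) \<le> F * norm x"
proof -
  obtain K where K: "\<And>x. cmod (f x) \<le> norm x * K"
    using assms by (auto simp: cbounded_functional_def)
  have "cmod (f x) \<le> \<bar>K\<bar> * norm x" for x
    using K[of x] mult_left_mono[OF abs_ge_self[of K] norm_ge_zero[of x]] by (simp add: mult.commute)
  then show ?thesis by (intro that[of "\<bar>K\<bar>"]) simp_all
qed

text \<open>Boundedness makes \<open>onorm\<close> of the compressed functional a genuine
  bound.\<close>

lemma bounded_linear_congruence:
  assumes f: "cbounded_functional f" shows "bounded_linear (\<lambda>x. f (s * x * s))"
proof -
  obtain F where F: "0 \<le> F" "\<And>x. cmod (f x) \<le> F * norm x"
    using cbounded_functional_bound[OF f] by blast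
  show ?thesis
  proof (rule bounded_linear_intro)
    show "cmod (f (s * x * s)) \<le> norm x * (F * (norm s * norm s))" for x
    proof -
      have "norm (s * x * s) \<le> norm s * norm x * norm s"
        by (meson mult_right_mono norm_ge_zero norm_mult_ineq order_trans)
      then have "F * norm (s * x * s) \<le> F * (norm s * norm x * norm s)"
        using F(1) by (rule mult_left_mono)
      then show ?thesis using F(2)[of "s * x * s"] by (simp add: mult_ac)
    qed
  qed (simp_all add: distrib_left distrib_right cbounded_functional_linear[OF f] scaleR_conv_of_real)
qed

text \<open>Compressing the positive elements \<open>norm x - x\<close> and
  \<open>norm x + x\<close> of the unitization by \<open>s\<close> gives positive elements of the
  algebra itself, where \<open>g\<close> can be evaluated.\<close>

lemma positive_functional_congruence_le:
  assumes g: "positive_functional g" and s: "cstar s = s" and x: "cstar x = x"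
  shows "\<bar>Re (g (s * x * s))\<bar> \<le> norm x * Re (g (s * s))"
proof -
  have lin: "cbounded_functional g" using g by (simp add: positive_functional_def)
  have es: "cstar (emb s) = emb s" and ex: "cstar (emb x) = emb x"
    using s x by (simp_all flip: emb_cstar)
  have "pos_element (emb s * (norm x *\<^sub>R 1 - emb x) * emb s)"
    by (intro pos_element_congruence pos_element_norm_minus es ex) (simp add: norm_emb)
  also have "emb s * (norm x *\<^sub>R 1 - emb x) * emb s = emb (norm x *\<^sub>R (s * s) - s * x * s)"
    by (simp add: emb_diff emb_scaleR emb_mult algebra_simps)
  finally have 1: "0 \<le> Re (g (norm x *\<^sub>R (s * s) - s * x * s))"
    using g by (simp add: positive_functional_def cstar_positive_iff_pos_element)
  have "pos_element (emb s * (emb x + norm x *\<^sub>R 1) * emb s)"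
    by (intro pos_element_congruence pos_element_norm_plus es ex) (simp add: norm_emb)
  also have "emb s * (emb x + norm x *\<^sub>R 1) * emb s = emb (s * x * s + norm x *\<^sub>R (s * s))"
    by (simp add: emb_add emb_scaleR emb_mult algebra_simps)
  finally have 2: "0 \<le> Re (g (s * x * s + norm x *\<^sub>R (s * s)))"
    using g by (simp add: positive_functional_def cstar_positive_iff_pos_element)
  show ?thesis using 1 2 by (simp add: cbounded_functional_linear[OF lin])
qed

lemma norm_hermitian_congruence_le:
  assumes f: "cbounded_functional f" "hermitian_functional f" and s: "cstar s = s"
    and M: "\<And>x. cstar x = x \<Longrightarrow> Re (f (s * x * s)) \<le> norm x * M" and M0: "0 \<le> M"
  shows "cmod (f (s * x * s)) \<le> M * norm x"
proof (cases "f (s * x * s) = 0")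
  case True
  then show ?thesis using M0 by simp
next
  case False
  define \<zeta> where "\<zeta> = f (s * x * s)"
  \<comment> \<open>The phase that rotates the value of the functional onto the nonnegative axis;
    hermiticity then lets \<open>y\<close> be replaced by its self-adjoint part
    \<open>w\<close>.\<close>
  define c where "c = cnj \<zeta> / cmod \<zeta>"
  have c: "cmod c = 1" "c * \<zeta> = cmod \<zeta>"
    using False by (simp_all add: c_def \<zeta>_def norm_divide complex_norm_square[symmetric] power2_eq_square
        mult.commute)
  define y where "y = scaleC c x"
  have fy: "f (s * y * s) = cmod \<zeta>"
    by (simp add: y_def mult_scaleC_left mult_scaleC_right cbounded_functional_linear[OF f(1)] c
        flip: \<zeta>_def)
  have "s * cstar y * s = cstar (s * y * s)" by (simp add: cstar_mult s mult.assoc)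
  then have fy': "f (s * cstar y * s) = cmod \<zeta>"
    using f(2) fy by (simp add: hermitian_functional_def)
  define w where "w = (1 / 2) *\<^sub>R (y + cstar y)"
  have "cstar w = w" by (simp add: w_def cstar_scaleR cstar_add cstar_cstar add.commute)
  then have "Re (f (s * w * s)) \<le> norm w * M" by (rule M)
  moreover have "f (s * w * s) = cmod \<zeta>"
    by (simp add: w_def distrib_left distrib_right cbounded_functional_linear[OF f(1)] fy fy')
  moreover have "norm w \<le> norm x"
    using norm_triangle_ineq[of y "cstar y"] by (simp add: w_def y_def norm_scaleC c)
  ultimately have "cmod \<zeta> \<le> norm x * M"
    using mult_right_mono[of "norm w" "norm x" M] M0 by simp
  then show ?thesis by (simp add: \<zeta>_def mult.commute)
qed

text \<open>Makes the norm a lower bound of the set whose infimum is taken.\<close>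

lemma onorm_le_decomposition:
  fixes a :: "'a::cstar_algebra"
  assumes a: "cstar_positive a" and f: "cbounded_functional f" "hermitian_functional f"
    and dec: "f = (\<lambda>x. f1 x - f2 x)" and f1: "positive_functional f1" and f2: "positive_functional f2"
  shows "onorm (\<lambda>x. f (cstar_sqrt a * x * cstar_sqrt a)) \<le> Re (f1 a + f2 a)"
proof (rule onorm_bound)
  let ?s = "cstar_sqrt a"
  have s: "cstar ?s = ?s" "?s * ?s = a"
    using cstar_sqrt_positive[OF a] by (simp_all add: cstar_positive_selfadjoint)
  show M0: "0 \<le> Re (f1 a + f2 a)" using f1 f2 a by (simp add: positive_functional_def)
  fix x :: 'a
  show "cmod (f (?s * x * ?s)) \<le> Re (f1 a + f2 a) * norm x"
  proof (rule norm_hermitian_congruence_le[OF f s(1) _ M0])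
    fix y :: 'a assume y: "cstar y = y"
    have "Re (f (?s * y * ?s)) \<le> \<bar>Re (f1 (?s * y * ?s))\<bar> + \<bar>Re (f2 (?s * y * ?s))\<bar>"
      by (simp add: dec)
    also have "\<dots> \<le> norm y * Re (f1 a) + norm y * Re (f2 a)"
      using positive_functional_congruence_le[OF f1 s(1) y]
        positive_functional_congruence_le[OF f2 s(1) y] unfolding s(2) by linarith
    finally show "Re (f (?s * y * ?s)) \<le> norm y * Re (f1 a + f2 a)" by (simp add: algebra_simps)
  qed
qed

text \<open>With \<open>\<rho> = \<surd>t s\<close> and \<open>c = \<rho> + \<kappa>\<close> one has \<open>c\<^sup>2 \<ge> t s\<^sup>2 + \<kappa>\<^sup>2\<close>, so
  \<open>z = c u c\<close> for some \<open>u\<close> in the unit ball, and \<open>c u c\<close> is close to \<open>t s u s\<close>.\<close>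
lemma order_interval_bound:
  fixes s z :: "'a::cstar_algebra" and f :: "'a \<Rightarrow> complex"
  assumes s: "cstar_positive s" and t: "0 \<le> t" and \<kappa>: "0 < \<kappa>"
    and z1: "pos_element (emb (t *\<^sub>R (s * s)) + \<kappa>\<^sup>2 *\<^sub>R 1 - emb z)"
    and z2: "pos_element (emb (t *\<^sub>R (s * s)) + \<kappa>\<^sup>2 *\<^sub>R 1 + emb z)"
    and f: "cbounded_functional f" and F: "\<And>x. cmod (f x) \<le> F * norm x" "0 \<le> F"
    and N: "\<And>x. cmod (f (s * x * s)) \<le> N * norm x" "0 \<le> N"
  shows "cmod (f z) \<le> t * N + F * (2 * \<kappa> * sqrt t * norm s + \<kappa>\<^sup>2)"
proof -
  define \<rho> where "\<rho> = sqrt t *\<^sub>R s"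
  define c where "c = emb \<rho> + \<kappa> *\<^sub>R 1"
  have \<rho>: "pos_element (emb \<rho>)"
    using cstar_positive_scaleR[OF s, of "sqrt t"] t by (simp add: \<rho>_def cstar_positive_iff_pos_element)
  have \<rho>\<rho>: "\<rho> * \<rho> = t *\<^sub>R (s * s)" using t by (simp add: \<rho>_def)
  have cc: "c * c = emb (t *\<^sub>R (s * s)) + \<kappa>\<^sup>2 *\<^sub>R 1 + (2 * \<kappa>) *\<^sub>R emb \<rho>"
  proof -
    have "(2 * \<kappa>) *\<^sub>R emb \<rho> = \<kappa> *\<^sub>R emb \<rho> + \<kappa> *\<^sub>R emb \<rho>" by (simp only: mult_2 scaleR_add_left)
    moreover have "emb (t *\<^sub>R (s * s)) = emb \<rho> * emb \<rho>" by (simp only: \<rho>\<rho>[symmetric] emb_mult)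
    ultimately show ?thesis unfolding c_def by (simp add: algebra_simps power2_eq_square)
  qed
  obtain g where g: "inverses c g"
    using pos_elementD[OF \<rho> \<kappa>] by (auto simp: unit_element_def c_def)
  have "cstar c = c" using \<rho> by (simp add: c_def cstar_add cstar_scaleR pos_element_selfadjoint)
  then have gs: "cstar g = g" using g by (rule inverses_selfadjoint[rotated])
  \<comment> \<open>This is \<open>u\<close>, obtained by cancelling \<open>c\<close> on both sides
    of \<open>z\<close>. Its scalar part vanishes because that of \<open>emb z\<close> does.\<close>
  define U where "U = g * emb z * g"
  have "scal U = 0" by (simp add: U_def scal_mult)
  then obtain u where u: "U = emb u" by (metis emb_alg)
  have gcc: "g * (c * c) * g = 1" using g by (simp add: inverses_cancel mult.assoc)
  \<comment> \<open>Adding this positive cross term to the two hypotheses completes their bounds to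
    \<open>c * c\<close>.\<close>
  have pos2: "pos_element ((2 * \<kappa>) *\<^sub>R emb \<rho>)" using \<kappa> \<rho> by (intro pos_element_scaleR) simp_all
  have "pos_element (g * (emb (t *\<^sub>R (s * s)) + \<kappa>\<^sup>2 *\<^sub>R 1 - emb z + (2 * \<kappa>) *\<^sub>R emb \<rho>) * g)"
    by (intro pos_element_congruence pos_element_add z1 pos2 gs)
  also have "emb (t *\<^sub>R (s * s)) + \<kappa>\<^sup>2 *\<^sub>R 1 - emb z + (2 * \<kappa>) *\<^sub>R emb \<rho> = c * c - emb z"
    unfolding cc by simp
  also have "g * (c * c - emb z) * g = 1 *\<^sub>R 1 - U"
    using gcc by (simp add: U_def left_diff_distrib right_diff_distrib)
  finally have u1: "pos_element (1 *\<^sub>R 1 - U)" .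
  have "pos_element (g * (emb (t *\<^sub>R (s * s)) + \<kappa>\<^sup>2 *\<^sub>R 1 + emb z + (2 * \<kappa>) *\<^sub>R emb \<rho>) * g)"
    by (intro pos_element_congruence pos_element_add z2 pos2 gs)
  also have "emb (t *\<^sub>R (s * s)) + \<kappa>\<^sup>2 *\<^sub>R 1 + emb z + (2 * \<kappa>) *\<^sub>R emb \<rho> = c * c + emb z"
    unfolding cc by simp
  also have "g * (c * c + emb z) * g = 1 *\<^sub>R 1 + U"
    using gcc by (simp add: U_def distrib_left distrib_right)
  finally have "norm U \<le> 1" using u1 by (intro norm_le_if_pos_element) simp_all
  then have nu: "norm u \<le> 1" by (simp add: u norm_emb)
  have "emb z = c * U * c" using g by (simp add: U_def inverses_cancel mult.assoc)
  also have "\<dots> = emb (\<rho> * u * \<rho> + \<kappa> *\<^sub>R (\<rho> * u + u * \<rho>) + \<kappa>\<^sup>2 *\<^sub>R u)"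
    by (simp add: c_def u emb_add emb_mult emb_scaleR algebra_simps power2_eq_square)
  also have "\<rho> * u * \<rho> = t *\<^sub>R (s * u * s)" using t by (simp add: \<rho>_def)
  finally have z: "z = t *\<^sub>R (s * u * s) + \<kappa> *\<^sub>R (\<rho> * u + u * \<rho>) + \<kappa>\<^sup>2 *\<^sub>R u"
    by (simp add: emb_eq_iff)
  have N0: "cmod (f (s * u * s)) \<le> N"
    using N(1)[of u] mult_left_mono[OF nu N(2)] by simp
  have n\<rho>: "norm \<rho> = sqrt t * norm s" using t by (simp add: \<rho>_def)
  have fb: "cmod (f x) \<le> F * r" if "norm x \<le> r" for x r
    using F(1)[of x] mult_left_mono[OF that F(2)] by linarith
  have "norm (\<rho> * u) \<le> norm \<rho>" "norm (u * \<rho>) \<le> norm \<rho>"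
    using nu mult_left_mono[OF nu norm_ge_zero[of \<rho>]] mult_right_mono[OF nu norm_ge_zero[of \<rho>]]
      norm_mult_ineq[of \<rho> u] norm_mult_ineq[of u \<rho>] by simp_all
  then have "norm (\<rho> * u + u * \<rho>) \<le> 2 * norm \<rho>" by norm
  then have 2: "cmod (f (\<rho> * u + u * \<rho>)) \<le> F * (2 * norm \<rho>)" by (rule fb)
  have 3: "cmod (f u) \<le> F * 1" using nu by (rule fb)
  have "f z = of_real t * f (s * u * s) + of_real \<kappa> * f (\<rho> * u + u * \<rho>) + of_real (\<kappa>\<^sup>2) * f u"
    unfolding z by (simp only: cbounded_functional_linear[OF f])
  then have "cmod (f z) \<le> cmod (of_real t * f (s * u * s)) + cmod (of_real \<kappa> * f (\<rho> * u + u * \<rho>)) +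
      cmod (of_real (\<kappa>\<^sup>2) * f u)"
    by (simp only:) (intro order_trans[OF norm_triangle_ineq] add_mono norm_triangle_ineq order_refl)
  also have "\<dots> = t * cmod (f (s * u * s)) + \<kappa> * cmod (f (\<rho> * u + u * \<rho>)) + \<kappa>\<^sup>2 * cmod (f u)"
    using t \<kappa> by (simp add: norm_mult norm_power)
  also have "\<dots> \<le> t * N + \<kappa> * (F * (2 * norm \<rho>)) + \<kappa>\<^sup>2 * (F * 1)"
    using t \<kappa> N0 2 3 by (intro add_mono mult_left_mono) simp_all
  finally show ?thesis by (simp add: n\<rho> algebra_simps)
qed

text \<open>Only the values of \<open>h\<close> on self-adjoint elements are kept: \<open>r\<close>
  precomposes \<open>h\<close> with the projection to the self-adjoint part, and complex linearity
  forces the imaginary part to be \<open>- r (scaleC \<i> x)\<close>.\<close>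

lemma complexify_selfadjoint_functional:
  fixes h :: "'a::cstar_algebra \<Rightarrow> real"
  assumes lin: "linear h" and K: "\<And>x. \<bar>h x\<bar> \<le> K * norm x"
  shows "\<exists>g. cbounded_functional g \<and> (\<forall>x. cstar x = x \<longrightarrow> g x = complex_of_real (h x))"
proof -
  define r where "r x = h ((1 / 2) *\<^sub>R (x + cstar x))" for x
  define g where "g x = Complex (r x) (- r (scaleC \<i> x))" for x
  have radd: "r (x + y) = r x + r y" for x y
    by (simp add: r_def cstar_add scaleR_add_right linear_add[OF lin])
  have rscale: "r (c *\<^sub>R x) = c * r x" for c x
  proof -
    have "(1 / 2) *\<^sub>R (c *\<^sub>R x + cstar (c *\<^sub>R x)) = c *\<^sub>R ((1 / 2) *\<^sub>R (x + cstar x))"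
      by (simp add: cstar_scaleR scaleR_add_right)
    then show ?thesis by (simp only: r_def linear_cmul[OF lin] real_scaleR_def)
  qed
  have rminus: "r (- x) = - r x" for x using rscale[of "-1" x] by simp
  have gadd: "g (x + y) = g x + g y" for x y
    by (simp add: g_def radd scaleC_add_right complex_eq_iff)
  have ii: "scaleC \<i> (scaleC \<i> x) = - x" for x :: 'a
    by (simp add: scaleC_scaleC scaleC_minus_left scaleC_one)
  have gscaleR: "g (c *\<^sub>R x) = of_real c * g x" for c x
  proof -
    have "scaleC \<i> (c *\<^sub>R x) = c *\<^sub>R scaleC \<i> x" by (simp add: scaleR_scaleC scaleC_scaleC mult.commute)
    then show ?thesis by (simp add: g_def rscale complex_eq_iff)
  qed
  have gi: "g (scaleC \<i> x) = \<i> * g x" for x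
    by (simp add: g_def ii rminus complex_eq_iff)
  have gscale: "g (scaleC c x) = c * g x" for c x
  proof -
    have "scaleC c x = scaleC (of_real (Re c) + of_real (Im c) * \<i>) x"
      by (metis complex_eq mult.commute)
    also have "\<dots> = Re c *\<^sub>R x + Im c *\<^sub>R scaleC \<i> x"
      by (simp add: scaleC_add_left scaleR_scaleC scaleC_scaleC)
    finally have "g (scaleC c x) = (of_real (Re c) + of_real (Im c) * \<i>) * g x"
      by (simp add: gadd gscaleR gi distrib_right mult.assoc)
    then show ?thesis by (metis complex_eq mult.commute)
  qed
  have rb: "\<bar>r x\<bar> \<le> \<bar>K\<bar> * norm x" for x
  proof -
    have "norm ((1 / 2) *\<^sub>R (x + cstar x)) \<le> norm x"
      using norm_triangle_ineq[of x "cstar x"] by simp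
    then have "\<bar>K\<bar> * norm ((1 / 2) *\<^sub>R (x + cstar x)) \<le> \<bar>K\<bar> * norm x"
      by (rule mult_left_mono) simp
    moreover have "K * norm ((1 / 2) *\<^sub>R (x + cstar x)) \<le> \<bar>K\<bar> * norm ((1 / 2) *\<^sub>R (x + cstar x))"
      by (intro mult_right_mono) simp_all
    ultimately show ?thesis using K[of "(1 / 2) *\<^sub>R (x + cstar x)"] unfolding r_def by linarith
  qed
  have "cmod (g x) \<le> norm x * (2 * \<bar>K\<bar>)" for x
  proof -
    have "cmod (g x) \<le> \<bar>r x\<bar> + \<bar>r (scaleC \<i> x)\<bar>"
      using cmod_le[of "g x"] by (simp add: g_def)
    then show ?thesis using rb[of x] rb[of "scaleC \<i> x"] by (simp add: norm_scaleC algebra_simps)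
  qed
  then have "cbounded_functional g"
    using gadd gscale by (auto simp: cbounded_functional_def)
  moreover have "g x = complex_of_real (h x)" if x: "cstar x = x" for x
  proof -
    have "(1 / 2) *\<^sub>R (x + cstar x) = x" using x by simp
    then have "r x = h x" by (simp only: r_def)
    moreover have "r (scaleC \<i> x) = 0"
      by (simp add: r_def cstar_scaleC x scaleC_minus_left linear_0[OF lin])
    ultimately show ?thesis by (simp add: g_def complex_eq_iff)
  qed
  ultimately show ?thesis by blast
qed

lemma decomposition_exists:
  fixes a :: "'a::cstar_algebra"
  assumes a: "cstar_positive a" and f: "cbounded_functional f" "hermitian_functional f"
    and e: "0 < e"
  shows "\<exists>f1 f2. f = (\<lambda>x. f1 x - f2 x) \<and> positive_functional f1 \<and> positive_functional f2 \<and>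
    Re (f1 a + f2 a) \<le> onorm (\<lambda>x. f (cstar_sqrt a * x * cstar_sqrt a)) + e"
proof -
  note flin = cbounded_functional_linear[OF f(1)]
  define s where "s = cstar_sqrt a"
  have s: "cstar_positive s" "s * s = a" unfolding s_def using cstar_sqrt_positive[OF a] by simp_all
  define N where "N = onorm (\<lambda>x. f (s * x * s))"
  have N: "cmod (f (s * x * s)) \<le> N * norm x" for x
    unfolding N_def by (rule onorm[OF bounded_linear_congruence[OF f(1)]])
  have N0: "0 \<le> N"
    unfolding N_def by (rule onorm_pos_le[OF bounded_linear_congruence[OF f(1)]])
  obtain F where F: "0 \<le> F" "\<And>x. cmod (f x) \<le> F * norm x"
    using cbounded_functional_bound[OF f(1)] by blast
  \<comment> \<open>The second summand pays for the cross term of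
    \<open>order_interval_bound\<close> after it is split into \<open>e * t\<close> and a multiple
    of the square of \<open>\<kappa>\<close>.\<close>
  define K0 where "K0 = F + (F * norm s)\<^sup>2 / e"
  define K where "K = (K0 + F) / 2"
  \<comment> \<open>The cap for \<open>h a\<close>: a value of at most \<open>m\<close> gives
    \<open>2 * h a - Re (f a) \<le> N + e\<close>.\<close>
  define m where "m = (Re (f a) + N + e) / 2"
  have K0: "0 \<le> K0" "0 \<le> K" using F(1) e by (simp_all add: K0_def K_def)
  \<comment> \<open>Exactly what keeps points \<open>(0, \<alpha>)\<close> with
    \<open>\<alpha> < 0\<close> out of the cone \<open>C\<close> below.\<close>
  have key: "2 * Re (f y) \<le> 2 * (t * m + K * norm (t *\<^sub>R a - y - x))"
    if t: "0 \<le> t" and x: "cstar_positive x" and y: "cstar_positive y" for t x y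
  proof -
    define v where "v = t *\<^sub>R a - y - x"
    have v: "cstar v = v"
      using a x y by (simp add: v_def cstar_diff cstar_scaleR cstar_positive_selfadjoint)
    have ev: "cstar (emb v) = emb v" using v by (simp flip: emb_cstar)
    have bound: "Re (f (y - x)) \<le> t * (N + e) + K0 * \<kappa>\<^sup>2" if \<kappa>: "0 < \<kappa>" "norm v \<le> \<kappa>\<^sup>2" for \<kappa>
    proof -
      have vpos: "pos_element (emb v + \<kappa>\<^sup>2 *\<^sub>R 1)"
        using \<kappa> ev by (intro pos_element_norm_plus) (simp_all add: norm_emb)
      \<comment> \<open>Adding \<open>2 x\<close>, and later \<open>2 y\<close>, to the positive
        \<open>v + \<kappa>\<^sup>2\<close> bounds \<open>y - x\<close> from above and from
        below.\<close>
      have "pos_element (emb v + \<kappa>\<^sup>2 *\<^sub>R 1 + 2 *\<^sub>R emb x)"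
        using x by (intro pos_element_add vpos pos_element_scaleR) (simp_all add: cstar_positive_iff_pos_element)
      also have "emb v + \<kappa>\<^sup>2 *\<^sub>R 1 + 2 *\<^sub>R emb x = emb (t *\<^sub>R (s * s)) + \<kappa>\<^sup>2 *\<^sub>R 1 - emb (y - x)"
        by (simp add: v_def s(2) emb_diff emb_add scaleR_2 algebra_simps)
      finally have 1: "pos_element (emb (t *\<^sub>R (s * s)) + \<kappa>\<^sup>2 *\<^sub>R 1 - emb (y - x))" .
      have "pos_element (emb v + \<kappa>\<^sup>2 *\<^sub>R 1 + 2 *\<^sub>R emb y)"
        using y by (intro pos_element_add vpos pos_element_scaleR) (simp_all add: cstar_positive_iff_pos_element)
      also have "emb v + \<kappa>\<^sup>2 *\<^sub>R 1 + 2 *\<^sub>R emb y = emb (t *\<^sub>R (s * s)) + \<kappa>\<^sup>2 *\<^sub>R 1 + emb (y - x)"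
        by (simp add: v_def s(2) emb_diff emb_add scaleR_2 algebra_simps)
      finally have 2: "pos_element (emb (t *\<^sub>R (s * s)) + \<kappa>\<^sup>2 *\<^sub>R 1 + emb (y - x))" .
      have "Re (f (y - x)) \<le> t * N + F * (2 * \<kappa> * sqrt t * norm s + \<kappa>\<^sup>2)"
        using order_interval_bound[OF s(1) t \<kappa>(1) 1 2 f(1) F(2) F(1) N N0] complex_Re_le_cmod order_trans
        by blast
      also have "\<dots> \<le> t * (N + e) + K0 * \<kappa>\<^sup>2"
      proof -
        \<comment> \<open>Completing the square bounds the mixed term in \<open>\<kappa>\<close> and
          \<open>sqrt t\<close>.\<close>
        have "0 \<le> (sqrt e * sqrt t - F * norm s * \<kappa> / sqrt e)\<^sup>2" by simp
        also have "\<dots> = e * t - 2 * (F * norm s * \<kappa> * sqrt t) + (F * norm s)\<^sup>2 / e * \<kappa>\<^sup>2"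
          using e t by (simp add: power2_diff power_mult_distrib power_divide)
        finally show ?thesis by (simp add: K0_def algebra_simps)
      qed
      finally show ?thesis .
    qed
    have "Re (f (y - x)) \<le> t * (N + e) + K0 * norm v"
    proof (rule field_le_epsilon)
      fix d :: real assume d: "0 < d"
      \<comment> \<open>The slack keeps \<open>\<kappa>\<close> positive even when
        \<open>v = 0\<close>, and costs at most \<open>d\<close>.\<close>
      define \<kappa> where "\<kappa> = sqrt (norm v + d / (1 + K0))"
      have pos: "0 < norm v + d / (1 + K0)" using d K0 by (intro add_nonneg_pos) simp_all
      have \<kappa>: "0 < \<kappa>" "\<kappa>\<^sup>2 = norm v + d / (1 + K0)" using pos by (simp_all add: \<kappa>_def)
      have "Re (f (y - x)) \<le> t * (N + e) + K0 * (norm v + d / (1 + K0))"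
        using bound[of \<kappa>] \<kappa> d K0 by simp
      also have "K0 * (d / (1 + K0)) \<le> d" using K0 d by (simp add: field_simps)
      then have "t * (N + e) + K0 * (norm v + d / (1 + K0)) \<le> t * (N + e) + K0 * norm v + d"
        by (simp add: algebra_simps)
      finally show "Re (f (y - x)) \<le> t * (N + e) + K0 * norm v + d" .
    qed
    moreover have "2 *\<^sub>R y = t *\<^sub>R a - v + (y - x)" by (simp add: v_def scaleR_2)
    then have "f (2 *\<^sub>R y) = f (t *\<^sub>R a - v + (y - x))" by (rule arg_cong)
    then have "2 * Re (f y) = t * Re (f a) - Re (f v) + Re (f (y - x))"
      by (simp add: flin)
    moreover have "- Re (f v) \<le> F * norm v"
      using F(2)[of v] abs_Re_le_cmod[of "f v"] by linarith
    moreover have "2 * (t * m + K * norm v) = t * (N + e) + t * Re (f a) + K0 * norm v + F * norm v"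
      by (simp add: m_def K_def field_simps)
    ultimately show ?thesis unfolding v_def[symmetric] by linarith
  qed
  \<comment> \<open>The generators encode the constraints: \<open>(a, m)\<close> caps
    \<open>h a\<close>, \<open>(- y, - Re (f y))\<close> gives \<open>h \<ge> f\<close> on positive
    elements, \<open>(- x, 0)\<close> gives \<open>h \<ge> 0\<close> there, and
    \<open>(v, K * norm v)\<close> gives continuity.\<close>
  define C where "C = {(w, \<alpha>). \<exists>t x y v. 0 \<le> t \<and> cstar_positive x \<and> cstar_positive y \<and>
    w = t *\<^sub>R a - y - x + v \<and> t * m - Re (f y) + K * norm v \<le> \<alpha>}"
  have CI: "(w, \<alpha>) \<in> C" if "0 \<le> t" "cstar_positive x" "cstar_positive y"
    "w = t *\<^sub>R a - y - x + v" "t * m - Re (f y) + K * norm v \<le> \<alpha>" for w \<alpha> t x y v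
    using that unfolding C_def by blast
  have "\<exists>h. linear h \<and> (\<forall>w \<alpha>. (w, \<alpha>) \<in> C \<longrightarrow> h w \<le> \<alpha>)"
  proof (rule hahn_banach_cone)
    show "convex_cone C"
      unfolding convex_cone_iff
    proof (intro conjI ballI allI impI)
      show "0 \<in> C"
        using CI[of 0 0 0 0 0 0] by (simp add: cstar_positive_zero flin zero_prod_def)
    next
      fix p q assume "p \<in> C" "q \<in> C"
      then obtain t x y v t' x' y' v' where
        1: "0 \<le> t" "cstar_positive x" "cstar_positive y" "fst p = t *\<^sub>R a - y - x + v"
          "t * m - Re (f y) + K * norm v \<le> snd p" and
        2: "0 \<le> t'" "cstar_positive x'" "cstar_positive y'" "fst q = t' *\<^sub>R a - y' - x' + v'"
          "t' * m - Re (f y') + K * norm v' \<le> snd q"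
        unfolding C_def by (auto simp: case_prod_beta)
      have "(fst p + fst q, snd p + snd q) \<in> C"
      proof (rule CI[of "t + t'" "x + x'" "y + y'" _ "v + v'"])
        show "fst p + fst q = (t + t') *\<^sub>R a - (y + y') - (x + x') + (v + v')"
          by (simp add: 1(4) 2(4) algebra_simps)
        have "K * norm (v + v') \<le> K * norm v + K * norm v'"
          using mult_left_mono[OF norm_triangle_ineq K0(2), of v v'] by (simp add: distrib_left)
        then show "(t + t') * m - Re (f (y + y')) + K * norm (v + v') \<le> snd p + snd q"
          using 1(5) 2(5) by (simp add: flin algebra_simps)
      qed (use 1 2 in \<open>simp_all add: cstar_positive_add\<close>)
      then show "p + q \<in> C" by (simp add: plus_prod_def)
    next
      fix p and c :: real assume "p \<in> C" and c: "0 \<le> c"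
      then obtain t x y v where
        1: "0 \<le> t" "cstar_positive x" "cstar_positive y" "fst p = t *\<^sub>R a - y - x + v"
          "t * m - Re (f y) + K * norm v \<le> snd p"
        unfolding C_def by (auto simp: case_prod_beta)
      have "(c *\<^sub>R fst p, c * snd p) \<in> C"
      proof (rule CI[of "c * t" "c *\<^sub>R x" "c *\<^sub>R y" _ "c *\<^sub>R v"])
        show "c *\<^sub>R fst p = (c * t) *\<^sub>R a - c *\<^sub>R y - c *\<^sub>R x + c *\<^sub>R v"
          by (simp add: 1(4) algebra_simps)
        show "c * t * m - Re (f (c *\<^sub>R y)) + K * norm (c *\<^sub>R v) \<le> c * snd p"
          using mult_left_mono[OF 1(5) c] c by (simp add: flin algebra_simps)
      qed (use 1 c in \<open>simp_all add: cstar_positive_scaleR\<close>)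
      then show "c *\<^sub>R p \<in> C" by (simp add: scaleR_prod_def)
    qed
    show "\<exists>\<alpha>. (w, \<alpha>) \<in> C" for w
      using CI[of 0 0 0 w w "K * norm w"] by (auto simp: cstar_positive_zero flin)
    fix \<alpha> assume "(0, \<alpha>) \<in> C"
    then obtain t x y v where 1: "0 \<le> t" "cstar_positive x" "cstar_positive y"
      and v: "0 = t *\<^sub>R a - y - x + v" and le: "t * m - Re (f y) + K * norm v \<le> \<alpha>"
      unfolding C_def by blast
    have "v = - (t *\<^sub>R a - y - x)" using v by (metis add_eq_0_iff)
    then have "norm v = norm (t *\<^sub>R a - y - x)" by (metis norm_minus_cancel)
    then show "0 \<le> \<alpha>" using key[OF 1] le by simp
  qed
  then obtain h where lin: "linear h" and h: "\<And>w \<alpha>. (w, \<alpha>) \<in> C \<Longrightarrow> h w \<le> \<alpha>" by blast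
  have ha: "h a \<le> m"
    by (rule h, rule CI[of 1 0 0 _ 0]) (simp_all add: cstar_positive_zero flin)
  have hpos: "0 \<le> h x" if "cstar_positive x" for x
  proof -
    have "h (- x) \<le> 0"
      by (rule h, rule CI[of 0 x 0 _ 0]) (simp_all add: cstar_positive_zero flin that)
    then show ?thesis by (simp add: linear_neg[OF lin])
  qed
  have hf: "Re (f y) \<le> h y" if "cstar_positive y" for y
  proof -
    have "h (- y) \<le> - Re (f y)"
      by (rule h, rule CI[of 0 0 y _ 0]) (simp_all add: cstar_positive_zero flin that)
    then show ?thesis by (simp add: linear_neg[OF lin])
  qed
  have hK: "h v \<le> K * norm v" for v
    by (rule h, rule CI[of 0 0 0 _ v]) (simp_all add: cstar_positive_zero flin)
  have "\<bar>h v\<bar> \<le> K * norm v" for v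
    using hK[of v] hK[of "- v"] by (simp add: linear_neg[OF lin] abs_le_iff)
  then obtain f1 where f1: "cbounded_functional f1"
    and f1h: "\<And>x. cstar x = x \<Longrightarrow> f1 x = complex_of_real (h x)"
    using complexify_selfadjoint_functional[OF lin] by blast
  define f2 where "f2 x = f1 x - f x" for x
  have "cbounded_functional f2"
  proof -
    obtain F1 where F1: "\<And>x. cmod (f1 x) \<le> F1 * norm x"
      using cbounded_functional_bound[OF f1] by blast
    have "cmod (f2 x) \<le> norm x * (F1 + F)" for x
      using norm_triangle_ineq4[of "f1 x" "f x"] F1[of x] F(2)[of x] by (simp add: f2_def algebra_simps)
    then have "\<exists>K. \<forall>x. cmod (f2 x) \<le> norm x * K" by blast
    then show ?thesis
      unfolding cbounded_functional_def
      by (simp add: f2_def flin cbounded_functional_linear[OF f1] right_diff_distrib)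
  qed
  moreover have "Im (f x) = 0" if "cstar x = x" for x
    using f(2) that unfolding hermitian_functional_def by (metis add.inverse_neutral cnj.simps(2) equal_neg_zero)
  ultimately have "positive_functional f2"
    using hf by (auto simp: positive_functional_def f2_def f1h cstar_positive_selfadjoint)
  moreover have "positive_functional f1"
    using f1 hpos by (auto simp: positive_functional_def f1h cstar_positive_selfadjoint)
  moreover have "f = (\<lambda>x. f1 x - f2 x)" by (simp add: f2_def)
  \<comment> \<open>The left side is \<open>2 * h a - Re (f a)\<close>, and
    \<open>h a \<le> m\<close>.\<close>
  moreover have "Re (f1 a + f2 a) \<le> N + e"
    using ha by (simp add: f2_def f1h cstar_positive_selfadjoint[OF a] m_def field_simps)
  ultimately show ?thesis unfolding N_def s_def by blast
qed

theorem theorem14: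
  fixes a :: "'a::cstar_algebra" and f :: "'a \<Rightarrow> complex"
  assumes "cstar_positive a"
    and "cbounded_functional f"
    and "hermitian_functional f"
  shows "onorm (\<lambda>x. f (cstar_sqrt a * x * cstar_sqrt a)) =
         Inf {Re (f1 a + f2 a) | f1 f2. f = (\<lambda>x. f1 x - f2 x) \<and>
                 positive_functional f1 \<and> positive_functional f2}"
    (is "?N = Inf ?S")
proof (rule antisym)
  have lower: "?N \<le> r" if "r \<in> ?S" for r
    using that onorm_le_decomposition[OF assms] by blast
  have near: "\<exists>r\<in>?S. r \<le> ?N + e" if "0 < e" for e
    using decomposition_exists[OF assms that] by blast
  show "?N \<le> Inf ?S"
    \<comment> \<open>The instance \<open>e = 1\<close> serves only to show that the set is
      nonempty.\<close>
    using near[of 1] lower by (intro cInf_greatest) auto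
  show "Inf ?S \<le> ?N"
  proof (rule field_le_epsilon)
    fix e :: real assume "0 < e"
    then obtain r where r: "r \<in> ?S" "r \<le> ?N + e" using near by blast
    have "bdd_below ?S" using lower by (rule bdd_belowI)
    then have "Inf ?S \<le> r" by (rule cInf_lower[OF r(1)])
    then show "Inf ?S \<le> ?N + e" using r(2) by (rule order_trans)
  qed
qed

end
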